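(* Let $\mathbb F$ be any field. Every regular $m\times n\times q$ spatial matrix $\mathcal A$ over $\mathbb F$ with $n\le 2$ and $q\le 2$ is equivalent to one of the following spatial matrices (given by their horizontal slices): (1) $\|\,[1]\,\|$ ($1\times1\times1$); (2) $\|I_2\|$ ($2\times2\times1$); (3) $\left\|\begin{bmatrix}1\\0\end{bmatrix}\middle|\begin{bmatrix}0\\1\end{bmatrix}\right\|$ ($2\times1\times2$); (4) $\|[1\ 0]\,|\,[0\ 1]\|$ ($1\times2\times2$); (5) $\left\|\begin{bmatrix}1&0\\0&1\\0&0\end{bmatrix}\middle|\begin{bmatrix}0&0\\0&0\\0&1\end{bmatrix}\right\|$ ($3\times2\times2$); (6) $\left\|\begin{bmatrix}1&0\\0&1\\0&0\end{bmatrix}\middle|\begin{bmatrix}0&0\\1&0\\0&1\end{bmatrix}\right\|$ ($3\times2\times2$); (7) $\left\|\begin{bmatrix}1&0\\0&1\\0&0\\0&0\end{bmatrix}\middle|\begin{bmatrix}0&0\\0&0\\1&0\\0&1\end{bmatrix}\right\|$ ($4\times2\times2$); (8) $\mathcal A(v):=\left\|\begin{bmatrix}1&0\\0&1\end{bmatrix}\middle|\begin{bmatrix}0&v\\1&0\end{bmatrix}\right\|$ with $v\in\mathbb F$ ($2\times2\times2$); (9) only when $\operatorname{char}\mathbb F=2$: $\mathcal B(v):=\left\|\begin{bmatrix}1&0\\0&1\end{bmatrix}\middle|\begin{bmatrix}0&v\\1&1\end{bmatrix}\right\|$ with $v\in\mathbb F$ ($2\times2\times2$). These spatial matrices are pairwise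 inequivalent except for the following cases: - If $\operatorname{char}\mathbb F\ne2$, then $\mathcal A(v)$ is equivalent to each $\mathcal A(v')$ with $v'=vz$ for some nonzero $z\in\{a^2: a\in\mathbb F\}$. - If $\operatorname{char}\mathbb F=2$, then $\mathcal A(v)$ is equivalent to each $\mathcal A(v')$ with $v'=\frac{\alpha v+\beta}{\gamma v+\delta}$, where $\alpha,\beta,\gamma,\delta\in\{a^2:a\in\mathbb F\}$, $\alpha\delta+\beta\gamma\ne0$ and $\gamma v+\delta\ne0$; and $\mathcal B(v)$ is equivalent to each $\mathcal B(v')$ with $v'=v+\beta+\beta^2$ for some $\beta\in\mathbb F$. In particular, if $\mathbb F$ is algebraically closed, then every regular $m\times n\times q$ spatial matrix with $n\le2$ and $q\le2$ is equivalent to exactly one of the spatial matrices (1)–(7), $\mathcal A(0)$, and $\left\|\begin{bmatrix}1&0\\0&0\end{bmatrix}\middle|\begin{bmatrix}0&0\\0&1\end{bmatrix}\right\|$ ($2\times2\times2$).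
   Context: An $m\times n\times q$ spatial matrix over $\mathbb F$ is an array $\mathcal A=[a_{ijk}]$ ($1\le i\le m$, $1\le j\le n$, $1\le k\le q$) with entries in $\mathbb F$; it is written as $\|A_1|\dots|A_q\|$ where $A_k=[a_{ijk}]_{ij}$ ($m\times n$) are its horizontal slices. Two $m\times n\times q$ spatial matrices $[a_{ijk}]$ and $[b_{ijk}]$ are equivalent if there are nonsingular matrices $R=[r_{ii'}]$ ($m\times m$), $S=[s_{jj'}]$ ($n\times n$), $T=[t_{kk'}]$ ($q\times q$) with $b_{i'j'k'}=\sum_{i,j,k}a_{ijk}r_{ii'}s_{jj'}t_{kk'}$ for all $i',j',k'$. The spatial matrix $\mathcal A$ is regular if each of the three sets $\{[a_{ijk}]_{ij}:1\le k\le q\}$ (its $m\times n$ slices), $\{[a_{ijk}]_{ik}:1\le j\le n\}$ (its $m\times q$ slices) and $\{[a_{ijk}]_{jk}:1\le i\le m\}$ (its $n\times q$ slices) is linearly independent (as a family of matrices). *)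

theory Defs
  imports "Jordan_Normal_Form.Matrix" "HOL-Computational_Algebra.Polynomial"
begin

text \<open>A spatial matrix of size m x n x q is represented as (m, n, q, a), where
  a i j k is the entry a_{ijk}; indices are 0-based: i < m, j < n, k < q.
  Entries outside this range are irrelevant.\<close>
type_synonym 'a smat = "nat \<times> nat \<times> nat \<times> (nat \<Rightarrow> nat \<Rightarrow> nat \<Rightarrow> 'a)"

definition regular_smat :: "('a::field) smat \<Rightarrow> bool" where
  "regular_smat A \<longleftrightarrow> (case A of (m, n, q, a) \<Rightarrow>
     (\<forall>c. (\<forall>i<m. \<forall>j<n. (\<Sum>k<q. c k * a i j k) = 0) \<longrightarrow> (\<forall>k<q. c k = 0)) \<and>
     (\<forall>c. (\<forall>i<m. \<forall>k<q. (\<Sum>j<n. c j * a i j k) = 0) \<longrightarrow> (\<forall>j<n. c j = 0)) \<and>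
     (\<forall>c. (\<forall>j<n. \<forall>k<q. (\<Sum>i<m. c i * a i j k) = 0) \<longrightarrow> (\<forall>i<m. c i = 0)))"

definition equiv_smat :: "('a::field) smat \<Rightarrow> 'a smat \<Rightarrow> bool" where
  "equiv_smat A B \<longleftrightarrow> (case A of (m, n, q, a) \<Rightarrow> case B of (m', n', q', b) \<Rightarrow>
     m' = m \<and> n' = n \<and> q' = q \<and>
     (\<exists>R S T. R \<in> carrier_mat m m \<and> invertible_mat R \<and>
              S \<in> carrier_mat n n \<and> invertible_mat S \<and>
              T \<in> carrier_mat q q \<and> invertible_mat T \<and>
              (\<forall>i'<m. \<forall>j'<n. \<forall>k'<q.
                 b i' j' k' = (\<Sum>i<m. \<Sum>j<n. \<Sum>k<q. a i j k * R $$ (i, i') * S $$ (j, j') * T $$ (k, k')))))"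

text \<open>Spatial matrix given by its list of horizontal slices \<open>\<parallel>A_1|...|A_q\<parallel>\<close>,
  each slice given as a list of rows.  Entry a_{ijk} = (slice k) row i column j.\<close>
definition of_slices :: "'a list list list \<Rightarrow> 'a smat" where
  "of_slices Ss = (length (hd Ss), length (hd (hd Ss)), length Ss, (\<lambda>i j k. Ss ! k ! i ! j))"

datatype 'a canon = C1 | C2 | C3 | C4 | C5 | C6 | C7 | CA 'a | CB 'a | CD

fun canon_smat :: "('a::field) canon \<Rightarrow> 'a smat" where
  "canon_smat C1 = of_slices [[[1]]]"
| "canon_smat C2 = of_slices [[[1,0],[0,1]]]"
| "canon_smat C3 = of_slices [[[1],[0]], [[0],[1]]]"
| "canon_smat C4 = of_slices [[[1,0]], [[0,1]]]"
| "canon_smat C5 = of_slices [[[1,0],[0,1],[0,0]], [[0,0],[0,0],[0,1]]]"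
| "canon_smat C6 = of_slices [[[1,0],[0,1],[0,0]], [[0,0],[1,0],[0,1]]]"
| "canon_smat C7 = of_slices [[[1,0],[0,1],[0,0],[0,0]], [[0,0],[0,0],[1,0],[0,1]]]"
| "canon_smat (CA v) = of_slices [[[1,0],[0,1]], [[0,v],[1,0]]]"
| "canon_smat (CB v) = of_slices [[[1,0],[0,1]], [[0,v],[1,1]]]"
| "canon_smat CD = of_slices [[[1,0],[0,0]], [[0,0],[0,1]]]"

definition canon_forms :: "('a::field) canon set" where
  "canon_forms = {C1, C2, C3, C4, C5, C6, C7} \<union> range CA \<union>
     (if CHAR('a) = 2 then range CB else {})"

definition is_square :: "'a::field \<Rightarrow> bool" where
  "is_square z \<longleftrightarrow> (\<exists>a. z = a ^ 2)"

definition canon_rel :: "('a::field) canon \<Rightarrow> 'a canon \<Rightarrow> bool" where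
  "canon_rel f g \<longleftrightarrow>
     (if CHAR('a) \<noteq> 2 then
        (\<exists>v v' z. f = CA v \<and> g = CA v' \<and> z \<noteq> 0 \<and> is_square z \<and> v' = v * z)
      else
        (\<exists>v v' \<alpha> \<beta> \<gamma> \<delta>. f = CA v \<and> g = CA v' \<and> is_square \<alpha> \<and> is_square \<beta> \<and>
            is_square \<gamma> \<and> is_square \<delta> \<and> \<alpha> * \<delta> + \<beta> * \<gamma> \<noteq> 0 \<and> \<gamma> * v + \<delta> \<noteq> 0 \<and>
            v' = (\<alpha> * v + \<beta>) / (\<gamma> * v + \<delta>)) \<or>
        (\<exists>v v' \<beta>. f = CB v \<and> g = CB v' \<and> v' = v + \<beta> + \<beta> ^ 2))"

definition alg_closed_forms :: "('a::field) canon set" where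
  "alg_closed_forms = {C1, C2, C3, C4, C5, C6, C7, CA 0, CD}"

end

theory Submission
  imports Defs "Jordan_Normal_Form.Determinant"
begin

text \<open>If \<open>b\<close> is obtained from \<open>a\<close> by arbitrary matrices \<open>R\<close>, \<open>S\<close>, \<open>T\<close> and \<open>b\<close> is regular, then \<open>R\<close>,
  \<open>S\<close>, \<open>T\<close> are automatically nonsingular: a kernel vector of one of them is a linear relation between
  the corresponding slices of \<open>b\<close>. Hence reductions to canonical forms can ignore invertibility.

  An \<open>m \<times> n \<times> q\<close> regular spatial matrix is, up to the choice of \<open>R\<close>, an \<open>m\<close>-dimensional space of
  \<open>n \<times> q\<close> matrices, so \<open>m \<le> n q\<close>. If \<open>m = n q\<close> there is only one such space. For \<open>n = q = 2\<close> and
  \<open>m = 3\<close> it is the orthogonal complement of a nonzero matrix, classified by its rank; for \<open>m = 1\<close> it is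
  spanned by a nonsingular matrix. For \<open>m = 2\<close> one makes the first slice of the pencil the identity; the
  second one is not scalar, so it is similar to a companion matrix, whose trace is then normalised.

  The \<open>2 \<times> 2 \<times> 2\<close> forms are told apart by the binary quadratic form \<open>det (x A\<^sub>1 + y A\<^sub>2)\<close>, which is
  determined up to a scalar factor and a linear substitution.\<close>

section \<open>Linear relations\<close>

text \<open>Gaussian elimination, one coordinate at a time: a vector \<open>v p\<close> with nonzero
  coordinate \<open>j\<close> clears that coordinate from the others, to which the induction
  hypothesis applies.\<close>

lemma nontrivial_relation:
  fixes v :: "'i \<Rightarrow> 'j \<Rightarrow> 'a::field"
  assumes "finite J" "finite I" "card J < card I"
  shows "\<exists>c. (\<exists>i\<in>I. c i \<noteq> 0) \<and> (\<forall>j\<in>J. (\<Sum>i\<in>I. c i * v i j) = 0)"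
  using assms
proof (induction J arbitrary: I v rule: finite_induct)
  case empty
  then obtain i where "i \<in> I" by fastforce
  then show ?case by (intro exI[of _ "\<lambda>_. 1"]) auto
next
  case (insert j J)
  show ?case
  proof (cases "\<forall>i\<in>I. v i j = 0")
    case True
    obtain c where c: "\<exists>i\<in>I. c i \<noteq> 0" "\<forall>j\<in>J. (\<Sum>i\<in>I. c i * v i j) = 0"
      using insert.IH[of I v] insert.prems insert.hyps by auto
    then show ?thesis using True by (intro exI[of _ c]) auto
  next
    case False
    then obtain p where p: "p \<in> I" "v p j \<noteq> 0" by blast
    let ?w = "\<lambda>i l. v i l - v i j / v p j * v p l"
    have "card J < card (I - {p})"
      using insert.prems insert.hyps p by simp
    then obtain c where c: "\<exists>i\<in>I - {p}. c i \<noteq> 0"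
      "\<forall>l\<in>J. (\<Sum>i\<in>I - {p}. c i * ?w i l) = 0"
      using insert.IH[of "I - {p}" ?w] insert.prems by blast
    \<comment> \<open>The coefficient at \<open>p\<close> undoes the elimination: the
      \<open>d\<close>-combination of the \<open>v i\<close> is the \<open>c\<close>-combination of
      the cleared vectors \<open>?w i\<close>, whose coordinate \<open>j\<close> is 0.\<close>
    define d where "d = c(p := - (\<Sum>i\<in>I - {p}. c i * (v i j / v p j)))"
    have *: "(\<Sum>i\<in>I. d i * v i l) = (\<Sum>i\<in>I - {p}. c i * ?w i l)" for l
    proof -
      have "(\<Sum>i\<in>I. d i * v i l) = d p * v p l + (\<Sum>i\<in>I - {p}. d i * v i l)"
        using p insert.prems by (simp add: sum.remove)
      also have "(\<Sum>i\<in>I - {p}. d i * v i l) = (\<Sum>i\<in>I - {p}. c i * v i l)"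
        by (rule sum.cong) (auto simp: d_def)
      finally show ?thesis
        by (simp add: d_def algebra_simps sum_subtractf sum_distrib_left)
    qed
    have "(\<Sum>i\<in>I. d i * v i j) = 0"
      unfolding * using p by simp
    moreover have "\<exists>i\<in>I. d i \<noteq> 0" using c(1) by (auto simp: d_def)
    ultimately show ?thesis using c(2) * by (intro exI[of _ d]) simp
  qed
qed

lemma nontrivial_relation_in_hyperplane:
  fixes v :: "'i \<Rightarrow> 'j \<Rightarrow> 'a::field"
  assumes "finite J" "finite I" "card J \<le> card I" "\<exists>j\<in>J. N j \<noteq> 0"
    and orth: "\<And>i. i \<in> I \<Longrightarrow> (\<Sum>j\<in>J. v i j * N j) = 0"
  shows "\<exists>c. (\<exists>i\<in>I. c i \<noteq> 0) \<and> (\<forall>j\<in>J. (\<Sum>i\<in>I. c i * v i j) = 0)"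
proof -
  obtain p where p: "p \<in> J" "N p \<noteq> 0" using assms by blast
  have "card (J - {p}) < card I"
    using assms p by (metis card_Diff1_less order_less_le_trans)
  then obtain c where c: "\<exists>i\<in>I. c i \<noteq> 0" "\<forall>j\<in>J - {p}. (\<Sum>i\<in>I. c i * v i j) = 0"
    using nontrivial_relation[of "J - {p}" I v] assms by blast
  have "0 = (\<Sum>i\<in>I. c i * (\<Sum>j\<in>J. v i j * N j))" using orth by simp
  also have "\<dots> = (\<Sum>j\<in>J. N j * (\<Sum>i\<in>I. c i * v i j))"
    unfolding sum_distrib_left by (subst sum.swap) (simp add: mult_ac)
  also have "\<dots> = N p * (\<Sum>i\<in>I. c i * v i p)"
    using p assms c by (simp add: sum.remove)
  finally have "(\<Sum>i\<in>I. c i * v i p) = 0" using p by simp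
  then show ?thesis using c by blast
qed

text \<open>Here \<open>b\<close> is appended at index \<open>m\<close> to the vectors
  \<open>v i\<close>. Independence of the latter makes the coefficient of \<open>b\<close> nonzero,
  so the relation can be solved for \<open>b\<close>.\<close>

lemma in_span_if_dependent:
  fixes v :: "nat \<Rightarrow> 'j \<Rightarrow> 'a::field"
  assumes indep: "\<And>c. (\<forall>j\<in>J. (\<Sum>i<m. c i * v i j) = 0) \<Longrightarrow> \<forall>i<m. c i = 0"
    and dep: "\<exists>c. (\<exists>i\<in>{..<Suc m}. c i \<noteq> 0)
      \<and> (\<forall>j\<in>J. (\<Sum>i\<in>{..<Suc m}. c i * (if i < m then v i j else b j)) = 0)"
  shows "\<exists>r. \<forall>j\<in>J. b j = (\<Sum>i<m. v i j * r i)"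
proof -
  obtain c where c: "\<exists>i<Suc m. c i \<noteq> 0"
    and rel: "\<forall>j\<in>J. (\<Sum>i<m. c i * v i j) + c m * b j = 0"
  proof -
    obtain c where c: "\<exists>i\<in>{..<Suc m}. c i \<noteq> 0"
      "\<forall>j\<in>J. (\<Sum>i\<in>{..<Suc m}. c i * (if i < m then v i j else b j)) = 0"
      using dep by blast
    show ?thesis by (rule that[of c]) (use c in \<open>auto simp: add.commute\<close>)
  qed
  have "c m \<noteq> 0"
  proof
    assume "c m = 0"
    with rel have "\<forall>i<m. c i = 0" by (intro indep) auto
    with c \<open>c m = 0\<close> show False using less_Suc_eq by auto
  qed
  moreover have "b j = (\<Sum>i<m. v i j * (- c i / c m))" if "j \<in> J" for j
  proof -
    have "(\<Sum>i<m. v i j * (- c i / c m)) = - (\<Sum>i<m. c i * v i j) / c m"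
      by (simp add: sum_divide_distrib sum_negf mult.commute)
    also have "(\<Sum>i<m. c i * v i j) = - (c m * b j)" using rel that by (simp add: eq_neg_iff_add_eq_0)
    also have "- (- (c m * b j)) / c m = b j" using \<open>c m \<noteq> 0\<close> by simp
    finally show ?thesis by simp
  qed
  ultimately show ?thesis by (intro exI[of _ "\<lambda>i. - c i / c m"]) auto
qed

section \<open>The action of triples of matrices\<close>

definition act :: "nat \<Rightarrow> nat \<Rightarrow> nat \<Rightarrow> (nat \<Rightarrow> nat \<Rightarrow> 'a::field) \<Rightarrow> (nat \<Rightarrow> nat \<Rightarrow> 'a) \<Rightarrow>
    (nat \<Rightarrow> nat \<Rightarrow> 'a) \<Rightarrow> (nat \<Rightarrow> nat \<Rightarrow> nat \<Rightarrow> 'a) \<Rightarrow> nat \<Rightarrow> nat \<Rightarrow> nat \<Rightarrow> 'a" where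
  "act m n q r s t a i' j' k' = (\<Sum>i<m. \<Sum>j<n. \<Sum>k<q. a i j k * r i i' * s j j' * t k k')"

text \<open>\<open>equiv_smat\<close> without nonsingularity, hence only a preorder. Reductions are
  chained in this relation and become equivalences through \<open>equiv_smatI\<close>.\<close>

definition transforms_to :: "('a::field) smat \<Rightarrow> 'a smat \<Rightarrow> bool" where
  "transforms_to A B \<longleftrightarrow> (case A of (m, n, q, a) \<Rightarrow> case B of (m', n', q', b) \<Rightarrow>
     m' = m \<and> n' = n \<and> q' = q \<and>
     (\<exists>r s t. \<forall>i<m. \<forall>j<n. \<forall>k<q. b i j k = act m n q r s t a i j k))"

lemma transforms_toI:
  assumes "\<forall>i<m. \<forall>j<n. \<forall>k<q. b i j k = act m n q r s t a i j k"
  shows "transforms_to (m, n, q, a) (m, n, q, b)"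
  using assms unfolding transforms_to_def prod.case by (intro conjI refl exI)

lemma act_eq_sum_prod:
  "act m n q r s t a i' j' k' =
    (\<Sum>(i, j, k)\<in>{..<m} \<times> {..<n} \<times> {..<q}. a i j k * (r i i' * s j j' * t k k'))"
  unfolding act_def by (simp add: sum.cartesian_product mult.assoc)

text \<open>Successive actions compose to matrix products: once the two sums over index triples are
  exchanged, the inner one splits into three independent sums by \<open>prod3\<close>.\<close>

lemma act_act:
  assumes "\<And>i j k. i < m \<Longrightarrow> j < n \<Longrightarrow> k < q \<Longrightarrow> b i j k = act m n q r s t a i j k"
  shows "act m n q r' s' t' b i j k =
    act m n q (\<lambda>i i'. \<Sum>l<m. r i l * r' l i') (\<lambda>j j'. \<Sum>l<n. s j l * s' l j')
      (\<lambda>k k'. \<Sum>l<q. t k l * t' l k') a i j k"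
proof -
  let ?P = "{..<m} \<times> {..<n} \<times> {..<q}"
  have prod3: "(\<Sum>x<m. f x) * (\<Sum>y<n. g y) * (\<Sum>z<q. h z) =
      (\<Sum>(x, y, z)\<in>?P. f x * g y * h z)" for f g h :: "nat \<Rightarrow> 'a"
  proof -
    have "(\<Sum>(x, y, z)\<in>?P. f x * g y * h z) = (\<Sum>x<m. \<Sum>y<n. \<Sum>z<q. f x * g y * h z)"
      by (simp add: sum.cartesian_product)
    also have "\<dots> = (\<Sum>x<m. f x * (\<Sum>y<n. g y * (\<Sum>z<q. h z)))"
      by (simp add: sum_distrib_left mult.assoc)
    also have "\<dots> = (\<Sum>x<m. f x) * (\<Sum>y<n. g y) * (\<Sum>z<q. h z)"
      by (simp add: mult.assoc flip: sum_distrib_right)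
    finally show ?thesis by simp
  qed
  have "act m n q r' s' t' b i j k =
      (\<Sum>(x', y', z')\<in>?P. (\<Sum>(x, y, z)\<in>?P. a x y z * (r x x' * s y y' * t z z')) *
        (r' x' i * s' y' j * t' z' k))"
    unfolding act_eq_sum_prod[of m n q r' s' t' b]
    by (rule sum.cong) (auto simp: assms act_eq_sum_prod)
  also have "\<dots> = (\<Sum>(x, y, z)\<in>?P. a x y z *
      (\<Sum>(x', y', z')\<in>?P. (r x x' * r' x' i) * (s y y' * s' y' j) * (t z z' * t' z' k)))"
    unfolding sum_distrib_right sum_distrib_left split_def
    by (subst sum.swap) (simp add: mult_ac)
  also have "\<dots> = act m n q (\<lambda>i i'. \<Sum>l<m. r i l * r' l i') (\<lambda>j j'. \<Sum>l<n. s j l * s' l j')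
      (\<lambda>k k'. \<Sum>l<q. t k l * t' l k') a i j k"
    unfolding act_eq_sum_prod prod3 by simp
  finally show ?thesis .
qed

lemma transforms_to_trans [trans]:
  assumes "transforms_to A B" "transforms_to B C"
  shows "transforms_to A C"
proof -
  obtain m n q a where A: "A = (m, n, q, a)" by (cases A)
  obtain b where B: "B = (m, n, q, b)" using assms(1) A by (auto simp: transforms_to_def)
  obtain c where C: "C = (m, n, q, c)" using assms(2) B by (auto simp: transforms_to_def)
  obtain r s t where b: "\<And>i j k. i < m \<Longrightarrow> j < n \<Longrightarrow> k < q \<Longrightarrow> b i j k = act m n q r s t a i j k"
    using assms(1) unfolding A B transforms_to_def by auto
  obtain r' s' t' where c: "\<And>i j k. i < m \<Longrightarrow> j < n \<Longrightarrow> k < q \<Longrightarrow> c i j k = act m n q r' s' t' b i j k"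
    using assms(2) unfolding B C transforms_to_def by auto
  show ?thesis
    unfolding A C transforms_to_def prod.case
    by (intro conjI refl exI allI impI, subst c, assumption+, rule act_act[OF b])
qed

lemma invertible_mat_if_trivial_kernel:
  fixes r :: "nat \<Rightarrow> nat \<Rightarrow> 'a::field"
  assumes "\<And>c. (\<forall>i<m. (\<Sum>l<m. r i l * c l) = 0) \<Longrightarrow> \<forall>i<m. c i = 0"
  shows "invertible_mat (mat m m (\<lambda>(i, j). r i j))"
proof -
  let ?R = "mat m m (\<lambda>(i, j). r i j)"
  have "det ?R \<noteq> 0"
  proof
    assume "det ?R = 0"
    then obtain w where w: "w \<in> carrier_vec m" "w \<noteq> 0\<^sub>v m" "?R *\<^sub>v w = 0\<^sub>v m"
      using det_0_iff_vec_prod_zero[of ?R m] by auto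
    have "(\<Sum>l<m. r i l * w $ l) = 0" if "i < m" for i
    proof -
      have "(?R *\<^sub>v w) $ i = 0" using w that by simp
      then have "(\<Sum>l = 0..<m. vec m (r i) $ l * w $ l) = 0" using that w(1)
        by (simp add: scalar_prod_def)
      then show ?thesis by (simp add: lessThan_atLeast0)
    qed
    then have "\<forall>i<m. w $ i = 0" using assms[of "\<lambda>i. w $ i"] by simp
    then show False using w by (auto intro!: eq_vecI)
  qed
  \<comment> \<open>A matrix with nonzero determinant is a unit of the matrix ring;
    \<open>()\<close> only fills the extension slot of the ring record.\<close>
  then obtain B where "B \<in> carrier_mat m m" "B * ?R = 1\<^sub>m m" "?R * B = 1\<^sub>m m"
    using det_non_zero_imp_unit[of ?R m "()"] by (auto simp: Units_def ring_mat_def)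
  then show ?thesis
    unfolding invertible_mat_def inverts_mat_def by (auto intro!: exI[of _ B])
qed

text \<open>Each index of \<open>b\<close> enters through one factor only, so combining slices of
  \<open>b\<close> with coefficients \<open>c\<close> amounts to applying \<open>r\<close>,
  \<open>s\<close> or \<open>t\<close> to \<open>c\<close>. For \<open>c\<close> in the kernel the
  combination vanishes, and regularity gives \<open>c = 0\<close>.\<close>

lemma equiv_smatI:
  assumes tr: "transforms_to A B" and reg: "regular_smat B"
  shows "equiv_smat A B"
proof -
  obtain m n q a where A: "A = (m, n, q, a)" by (cases A)
  obtain b where B: "B = (m, n, q, b)" using tr A by (auto simp: transforms_to_def)
  obtain r s t where b: "\<And>i j k. i < m \<Longrightarrow> j < n \<Longrightarrow> k < q \<Longrightarrow> b i j k = act m n q r s t a i j k"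
    using tr unfolding A B transforms_to_def by auto
  have "invertible_mat (mat m m (\<lambda>(i, j). r i j))"
  proof (rule invertible_mat_if_trivial_kernel)
    fix c assume c: "\<forall>i<m. (\<Sum>l<m. r i l * c l) = 0"
    have "(\<Sum>l<m. c l * b l j k) = 0" if "j < n" "k < q" for j k
    proof -
      have "(\<Sum>l<m. c l * b l j k) =
          (\<Sum>i<m. (\<Sum>l<m. r i l * c l) * (\<Sum>y<n. \<Sum>z<q. a i y z * s y j * t z k))"
        unfolding sum_distrib_right
        by (subst sum.swap)
          (simp add: b that act_def sum_distrib_left mult_ac)
      then show ?thesis using c by simp
    qed
    then show "\<forall>i<m. c i = 0" using reg by (auto simp: regular_smat_def B)
  qed
  moreover have "invertible_mat (mat n n (\<lambda>(i, j). s i j))"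
  proof (rule invertible_mat_if_trivial_kernel)
    fix c assume c: "\<forall>i<n. (\<Sum>l<n. s i l * c l) = 0"
    have "(\<Sum>l<n. c l * b i l k) = 0" if "i < m" "k < q" for i k
    proof -
      have "(\<Sum>l<n. c l * b i l k) =
          (\<Sum>l<n. \<Sum>y<n. c l * s y l * (\<Sum>x<m. \<Sum>z<q. a x y z * r x i * t z k))"
        by (simp add: b that act_def sum_distrib_left sum.swap[of _ "{..<n}" "{..<m}"] mult_ac)
      also have "\<dots> = (\<Sum>y<n. (\<Sum>l<n. s y l * c l) * (\<Sum>x<m. \<Sum>z<q. a x y z * r x i * t z k))"
        unfolding sum_distrib_right by (subst sum.swap) (simp add: mult_ac)
      finally show ?thesis using c by simp
    qed
    then show "\<forall>i<n. c i = 0" using reg by (auto simp: regular_smat_def B)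
  qed
  moreover have "invertible_mat (mat q q (\<lambda>(i, j). t i j))"
  proof (rule invertible_mat_if_trivial_kernel)
    fix c assume c: "\<forall>i<q. (\<Sum>l<q. t i l * c l) = 0"
    have "(\<Sum>l<q. c l * b i j l) = 0" if "i < m" "j < n" for i j
    proof -
      have "(\<Sum>l<q. c l * b i j l) =
          (\<Sum>x<m. \<Sum>y<n. \<Sum>z<q. a x y z * r x i * s y j * (\<Sum>l<q. t z l * c l))"
        apply (simp add: b that act_def sum_distrib_left sum.swap[of _ "{..<m}" "{..<q}"]
          sum.swap[of _ "{..<n}" "{..<q}"] mult_ac)
        apply (rule sum.cong[OF refl], rule sum.cong[OF refl], rule sum.swap)
        done
      then show ?thesis using c by simp
    qed
    then show "\<forall>i<q. c i = 0" using reg by (auto simp: regular_smat_def B)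
  qed
  ultimately show ?thesis
    unfolding A B equiv_smat_def prod.case
    by (intro conjI refl exI[of _ "mat m m (\<lambda>(i, j). r i j)"] exI[of _ "mat n n (\<lambda>(i, j). s i j)"]
        exI[of _ "mat q q (\<lambda>(i, j). t i j)"]) (auto simp: b act_def)
qed

section \<open>Inverse triples and symmetry of equivalence\<close>

lemma invertible_mat_inverse:
  fixes R :: "'a::field mat"
  assumes "R \<in> carrier_mat m m" "invertible_mat R"
  obtains R' where "R' \<in> carrier_mat m m" "invertible_mat R'"
    "\<And>i j. i < m \<Longrightarrow> j < m \<Longrightarrow> (\<Sum>l<m. R $$ (i, l) * R' $$ (l, j)) = (if i = j then 1 else 0)"
    "\<And>i j. i < m \<Longrightarrow> j < m \<Longrightarrow> (\<Sum>l<m. R' $$ (i, l) * R $$ (l, j)) = (if i = j then 1 else 0)"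
proof -
  obtain R' where R': "inverts_mat R R'" "inverts_mat R' R"
    using assms(2) by (auto simp: invertible_mat_def)
  have e: "R * R' = 1\<^sub>m m" "R' * R = 1\<^sub>m (dim_row R')"
    using R' assms by (auto simp: inverts_mat_def)
  \<comment> \<open>\<open>inverts_mat\<close> does not state the size of \<open>R'\<close>; it is
    read off the sizes of the two products.\<close>
  have "dim_col R' = m" using arg_cong[OF e(1), of dim_col] by simp
  moreover have "dim_row R' = m"
    using arg_cong[OF e(2), of dim_col] assms(1) by simp
  ultimately have c: "R' \<in> carrier_mat m m" by auto
  have "(\<Sum>l<m. R $$ (i, l) * R' $$ (l, j)) = (if i = j then 1 else 0)" if "i < m" "j < m" for i j
    using arg_cong[OF e(1), of "\<lambda>M. M $$ (i, j)"] assms c that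
    by (simp add: scalar_prod_def lessThan_atLeast0)
  moreover have "(\<Sum>l<m. R' $$ (i, l) * R $$ (l, j)) = (if i = j then 1 else 0)" if "i < m" "j < m" for i j
    using arg_cong[OF e(2), of "\<lambda>M. M $$ (i, j)"] assms c that
    by (simp add: scalar_prod_def lessThan_atLeast0)
  moreover have "invertible_mat R'"
    using R' c unfolding invertible_mat_def by auto
  ultimately show ?thesis using c by (intro that)
qed

lemma act_cong:
  assumes "\<And>i. i < m \<Longrightarrow> r i i' = r' i i'" "\<And>j. j < n \<Longrightarrow> s j j' = s' j j'"
    "\<And>k. k < q \<Longrightarrow> t k k' = t' k k'"
  shows "act m n q r s t a i' j' k' = act m n q r' s' t' a i' j' k'"
  using assms by (simp add: act_def)

lemma act_one:
  assumes "i < m" "j < n" "k < q"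
  shows "act m n q (\<lambda>i i'. if i = i' then 1 else 0) (\<lambda>i i'. if i = i' then 1 else 0)
     (\<lambda>i i'. if i = i' then 1 else 0) a i j k = a i j k"
proof -
  have "x * (if P then 1 else 0) * y = (if P then x * y else 0)" for x y :: 'a and P by simp
  moreover have "x * (if P then 1 else 0) = (if P then x else 0)" for x :: 'a and P by simp
  ultimately show ?thesis using assms by (simp add: act_def)
qed

lemma equiv_smat_eq:
  "equiv_smat (m, n, q, a) (m, n, q, b) \<longleftrightarrow>
     (\<exists>R S T. R \<in> carrier_mat m m \<and> invertible_mat R \<and>
              S \<in> carrier_mat n n \<and> invertible_mat S \<and>
              T \<in> carrier_mat q q \<and> invertible_mat T \<and>
              (\<forall>i<m. \<forall>j<n. \<forall>k<q. b i j k =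
                 act m n q (\<lambda>i i'. R $$ (i, i')) (\<lambda>i i'. S $$ (i, i')) (\<lambda>i i'. T $$ (i, i')) a i j k))"
  by (simp add: equiv_smat_def act_def)

lemma equiv_imp_transforms:
  assumes "equiv_smat A B"
  shows "transforms_to A B"
proof -
  obtain m n q a where A: "A = (m, n, q, a)" by (cases A)
  obtain b where B: "B = (m, n, q, b)" using assms A by (auto simp: equiv_smat_def)
  obtain R S T where "\<forall>i<m. \<forall>j<n. \<forall>k<q. b i j k =
      act m n q (\<lambda>i i'. R $$ (i, i')) (\<lambda>i i'. S $$ (i, i')) (\<lambda>i i'. T $$ (i, i')) a i j k"
    using assms unfolding A B equiv_smat_eq by blast
  then show ?thesis unfolding A B transforms_to_def prod.case by (intro conjI refl exI)
qed

lemma equiv_smat_sym: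
  assumes "equiv_smat A B"
  shows "equiv_smat B A"
proof -
  obtain m n q a where A: "A = (m, n, q, a)" by (cases A)
  obtain b where B: "B = (m, n, q, b)" using assms A by (auto simp: equiv_smat_def)
  obtain R S T where RST: "R \<in> carrier_mat m m" "invertible_mat R"
    "S \<in> carrier_mat n n" "invertible_mat S" "T \<in> carrier_mat q q" "invertible_mat T"
    and b: "\<And>i j k. i < m \<Longrightarrow> j < n \<Longrightarrow> k < q \<Longrightarrow> b i j k =
      act m n q (\<lambda>i i'. R $$ (i, i')) (\<lambda>i i'. S $$ (i, i')) (\<lambda>i i'. T $$ (i, i')) a i j k"
    using assms unfolding A B equiv_smat_eq by blast
  obtain R' where R': "R' \<in> carrier_mat m m" "invertible_mat R'"
    "\<And>i j. i < m \<Longrightarrow> j < m \<Longrightarrow> (\<Sum>l<m. R $$ (i, l) * R' $$ (l, j)) = (if i = j then 1 else 0)"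
    using invertible_mat_inverse[OF RST(1,2)] by metis
  obtain S' where S': "S' \<in> carrier_mat n n" "invertible_mat S'"
    "\<And>i j. i < n \<Longrightarrow> j < n \<Longrightarrow> (\<Sum>l<n. S $$ (i, l) * S' $$ (l, j)) = (if i = j then 1 else 0)"
    using invertible_mat_inverse[OF RST(3,4)] by metis
  obtain T' where T': "T' \<in> carrier_mat q q" "invertible_mat T'"
    "\<And>i j. i < q \<Longrightarrow> j < q \<Longrightarrow> (\<Sum>l<q. T $$ (i, l) * T' $$ (l, j)) = (if i = j then 1 else 0)"
    using invertible_mat_inverse[OF RST(5,6)] by metis
  have "a i j k = act m n q (\<lambda>i i'. R' $$ (i, i')) (\<lambda>i i'. S' $$ (i, i')) (\<lambda>i i'. T' $$ (i, i')) b i j k"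
    if "i < m" "j < n" "k < q" for i j k
    by (subst act_act[OF b], assumption+, subst act_one[OF that, of a, symmetric], rule act_cong)
      (simp_all add: R' S' T' that)
  then show ?thesis unfolding A B equiv_smat_eq
    by (intro exI[of _ R'] exI[of _ S'] exI[of _ T'] conjI R' S' T') blast
qed

lemma transforms_to_pointwise:
  assumes "\<And>i j k. i < m \<Longrightarrow> j < n \<Longrightarrow> k < q \<Longrightarrow> b i j k = a i j k"
  shows "transforms_to (m, n, q, a) (m, n, q, b)"
  unfolding transforms_to_def prod.case
  by (intro conjI refl exI allI impI, subst assms, assumption+, rule act_one[symmetric])

text \<open>Supplies the regularity that \<open>equiv_smatI\<close> asks of its target, so that for
  canonical targets it suffices to show \<open>transforms_to\<close>.\<close>

lemma regular_canon_smat: "regular_smat (canon_smat f)"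
  by (cases f) (auto simp: regular_smat_def of_slices_def numeral_eq_Suc All_less_Suc)

section \<open>Pencils of 2 by 2 matrices\<close>

definition mat2 :: "'a \<Rightarrow> 'a \<Rightarrow> 'a \<Rightarrow> 'a \<Rightarrow> nat \<Rightarrow> nat \<Rightarrow> 'a" where
  "mat2 x y z w i j = (if i = 0 then if j = 0 then x else y else if j = 0 then z else w)"

lemma mat2_simps [simp]:
  "mat2 x y z w 0 0 = x" "mat2 x y z w 0 (Suc 0) = y"
  "mat2 x y z w (Suc 0) 0 = z" "mat2 x y z w (Suc 0) (Suc 0) = w"
  by (simp_all add: mat2_def)

definition pencil :: "'a::field \<Rightarrow> 'a \<Rightarrow> 'a \<Rightarrow> 'a \<Rightarrow> 'a \<Rightarrow> 'a \<Rightarrow> 'a \<Rightarrow> 'a \<Rightarrow> 'a smat" where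
  "pencil x y z w x' y' z' w' =
    (2, 2, 2, \<lambda>i j k. if k = 0 then mat2 x y z w i j else mat2 x' y' z' w' i j)"

text \<open>In this and the next two operations the first new row, column or slice has coefficients
  \<open>a\<close>, \<open>c\<close> and the second has \<open>b\<close>, \<open>d\<close>: the
  columns of \<open>mat2 a b c d\<close>.\<close>

lemma pencil_rows:
  "transforms_to (pencil x y z w x' y' z' w')
    (pencil (a * x + c * z) (a * y + c * w) (b * x + d * z) (b * y + d * w)
      (a * x' + c * z') (a * y' + c * w') (b * x' + d * z') (b * y' + d * w'))"
  unfolding pencil_def
  by (rule transforms_toI[where r = "mat2 a b c d" and s = "mat2 1 0 0 1" and t = "mat2 1 0 0 1"])
    (simp add: act_def numeral_eq_Suc All_less_Suc mult.commute)

lemma pencil_columns: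
  "transforms_to (pencil x y z w x' y' z' w')
    (pencil (a * x + c * y) (b * x + d * y) (a * z + c * w) (b * z + d * w)
      (a * x' + c * y') (b * x' + d * y') (a * z' + c * w') (b * z' + d * w'))"
  unfolding pencil_def
  by (rule transforms_toI[where r = "mat2 1 0 0 1" and s = "mat2 a b c d" and t = "mat2 1 0 0 1"])
    (simp add: act_def numeral_eq_Suc All_less_Suc mult.commute)

lemma pencil_slices:
  "transforms_to (pencil x y z w x' y' z' w')
    (pencil (a * x + c * x') (a * y + c * y') (a * z + c * z') (a * w + c * w')
      (b * x + d * x') (b * y + d * y') (b * z + d * z') (b * w + d * w'))"
  unfolding pencil_def
  by (rule transforms_toI[where r = "mat2 1 0 0 1" and s = "mat2 1 0 0 1" and t = "mat2 a b c d"])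
    (simp add: act_def numeral_eq_Suc All_less_Suc mult.commute)

lemma transforms_to_pencil:
  "transforms_to (2, 2, 2, a) (pencil (a 0 0 0) (a 0 1 0) (a 1 0 0) (a 1 1 0)
     (a 0 0 1) (a 0 1 1) (a 1 0 1) (a 1 1 1))"
  unfolding pencil_def
  by (rule transforms_to_pointwise) (auto simp: numeral_eq_Suc less_Suc_eq)

text \<open>Both sides have the same entries in range but may differ as functions outside it, so
  they are linked by \<open>transforms_to\<close> and not by equality.\<close>

lemma pencil_transforms_to_canon:
  "transforms_to (pencil 1 0 0 1 0 v 1 0) (canon_smat (CA v))"
  "transforms_to (pencil 1 0 0 1 0 v 1 1) (canon_smat (CB v))"
  "transforms_to (pencil 1 0 0 0 0 0 0 1) (canon_smat CD)"
  unfolding pencil_def canon_smat.simps of_slices_def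
  by (auto intro!: transforms_to_pointwise simp: numeral_eq_Suc less_Suc_eq)

lemma canon_transforms_to_pencil:
  "transforms_to (canon_smat (CA v)) (pencil 1 0 0 1 0 v 1 0)"
  "transforms_to (canon_smat (CB v)) (pencil 1 0 0 1 0 v 1 1)"
  unfolding pencil_def canon_smat.simps of_slices_def
  by (auto intro!: transforms_to_pointwise simp: numeral_eq_Suc less_Suc_eq)

section \<open>The determinant form of a pencil\<close>

lemma det_mult_det_inverse_2:
  fixes a b c d x y z w :: "'a::field"
  assumes "a * x + b * z = 1" "a * y + b * w = 0" "c * x + d * z = 0" "c * y + d * w = 1"
  shows "(a * d - b * c) * (x * w - y * z) = 1"
proof -
  have "(a * d - b * c) * (x * w - y * z) =
      (a * x + b * z) * (c * y + d * w) - (a * y + b * w) * (c * x + d * z)"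
    by (simp add: algebra_simps)
  then show ?thesis by (simp add: assms)
qed

lemma invertible_mat_2_det:
  fixes R :: "'a::field mat"
  assumes "R \<in> carrier_mat 2 2" "invertible_mat R"
  shows "R $$ (0, 0) * R $$ (1, 1) - R $$ (0, 1) * R $$ (1, 0) \<noteq> 0"
proof -
  obtain R' where
    "\<And>i j. i < 2 \<Longrightarrow> j < 2 \<Longrightarrow> (\<Sum>l<2. R $$ (i, l) * R' $$ (l, j)) = (if i = j then 1 else 0)"
    using invertible_mat_inverse[OF assms] by metis
  from this[of 0 0] this[of 0 1] this[of 1 0] this[of 1 1]
  have "R $$ (0, 0) * R' $$ (0, 0) + R $$ (0, 1) * R' $$ (1, 0) = 1"
    "R $$ (0, 0) * R' $$ (0, 1) + R $$ (0, 1) * R' $$ (1, 1) = 0"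
    "R $$ (1, 0) * R' $$ (0, 0) + R $$ (1, 1) * R' $$ (1, 0) = 0"
    "R $$ (1, 0) * R' $$ (0, 1) + R $$ (1, 1) * R' $$ (1, 1) = 1"
    by (simp_all add: numeral_eq_Suc)
  then have "(R $$ (0, 0) * R $$ (1, 1) - R $$ (0, 1) * R $$ (1, 0)) *
      (R' $$ (0, 0) * R' $$ (1, 1) - R' $$ (0, 1) * R' $$ (1, 0)) = 1"
    by (rule det_mult_det_inverse_2)
  then show ?thesis by force
qed

text \<open>The coefficients of the binary quadratic form
  \<open>det (x A\<^sub>1 + y A\<^sub>2) = det_xx x\<^sup>2 + det_xy x y + det_yy y\<^sup>2\<close>.\<close>

definition det_xx :: "(nat \<Rightarrow> nat \<Rightarrow> nat \<Rightarrow> 'a::field) \<Rightarrow> 'a" where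
  "det_xx a = a 0 0 0 * a 1 1 0 - a 0 1 0 * a 1 0 0"

definition det_xy :: "(nat \<Rightarrow> nat \<Rightarrow> nat \<Rightarrow> 'a::field) \<Rightarrow> 'a" where
  "det_xy a = a 0 0 0 * a 1 1 1 + a 0 0 1 * a 1 1 0 - a 0 1 0 * a 1 0 1 - a 0 1 1 * a 1 0 0"

definition det_yy :: "(nat \<Rightarrow> nat \<Rightarrow> nat \<Rightarrow> 'a::field) \<Rightarrow> 'a" where
  "det_yy a = a 0 0 1 * a 1 1 1 - a 0 1 1 * a 1 0 1"

text \<open>Row and column changes multiply both slices by fixed matrices and so scale the form by
  their determinants, collected in \<open>\<kappa>\<close>. A slice change substitutes
  \<open>t 0 0 x + t 0 1 y\<close> for \<open>x\<close> and \<open>t 1 0 x + t 1 1 y\<close> for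
  \<open>y\<close>.\<close>

lemma det_form_act:
  fixes r s t :: "nat \<Rightarrow> nat \<Rightarrow> 'a::field"
  assumes b: "\<And>i j k. i < 2 \<Longrightarrow> j < 2 \<Longrightarrow> k < 2 \<Longrightarrow> b i j k = act 2 2 2 r s t a i j k"
  defines "\<kappa> \<equiv> (r 0 0 * r 1 1 - r 0 1 * r 1 0) * (s 0 0 * s 1 1 - s 0 1 * s 1 0)"
  shows "det_xx b = \<kappa> * (det_xx a * (t 0 0)\<^sup>2 + det_xy a * t 0 0 * t 1 0 + det_yy a * (t 1 0)\<^sup>2)"
    and "det_xy b = \<kappa> * (2 * det_xx a * t 0 0 * t 0 1 +
      det_xy a * (t 0 0 * t 1 1 + t 0 1 * t 1 0) + 2 * det_yy a * t 1 0 * t 1 1)"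
    and "det_yy b = \<kappa> * (det_xx a * (t 0 1)\<^sup>2 + det_xy a * t 0 1 * t 1 1 + det_yy a * (t 1 1)\<^sup>2)"
proof -
  \<comment> \<open>\<open>c\<close> is \<open>a\<close> after the slice change only,
    \<open>d\<close> after the column change as well; each identity below then involves a single
    matrix.\<close>
  define c where "c i j k = a i j 0 * t 0 k + a i j 1 * t 1 k" for i j k
  define d where "d i j k = c i 0 k * s 0 j + c i 1 k * s 1 j" for i j k
  have bd: "b i j k = d 0 j k * r 0 i + d 1 j k * r 1 i" if "i < 2" "j < 2" "k < 2" for i j k
    unfolding b[OF that] act_def c_def d_def by (simp add: numeral_eq_Suc algebra_simps)
  have 1: "det_xx b = (r 0 0 * r 1 1 - r 0 1 * r 1 0) * det_xx d"
    "det_xy b = (r 0 0 * r 1 1 - r 0 1 * r 1 0) * det_xy d"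
    "det_yy b = (r 0 0 * r 1 1 - r 0 1 * r 1 0) * det_yy d"
    by (simp_all add: det_xx_def det_xy_def det_yy_def bd algebra_simps)
  have 2: "det_xx d = (s 0 0 * s 1 1 - s 0 1 * s 1 0) * det_xx c"
    "det_xy d = (s 0 0 * s 1 1 - s 0 1 * s 1 0) * det_xy c"
    "det_yy d = (s 0 0 * s 1 1 - s 0 1 * s 1 0) * det_yy c"
    by (simp_all add: det_xx_def det_xy_def det_yy_def d_def algebra_simps)
  have 3: "det_xx c = det_xx a * (t 0 0)\<^sup>2 + det_xy a * t 0 0 * t 1 0 + det_yy a * (t 1 0)\<^sup>2"
    "det_xy c = 2 * det_xx a * t 0 0 * t 0 1 +
      det_xy a * (t 0 0 * t 1 1 + t 0 1 * t 1 0) + 2 * det_yy a * t 1 0 * t 1 1"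
    "det_yy c = det_xx a * (t 0 1)\<^sup>2 + det_xy a * t 0 1 * t 1 1 + det_yy a * (t 1 1)\<^sup>2"
    by (simp_all add: det_xx_def det_xy_def det_yy_def c_def algebra_simps power2_eq_square)
  show "det_xx b = \<kappa> * (det_xx a * (t 0 0)\<^sup>2 + det_xy a * t 0 0 * t 1 0 + det_yy a * (t 1 0)\<^sup>2)"
    "det_xy b = \<kappa> * (2 * det_xx a * t 0 0 * t 0 1 +
      det_xy a * (t 0 0 * t 1 1 + t 0 1 * t 1 0) + 2 * det_yy a * t 1 0 * t 1 1)"
    "det_yy b = \<kappa> * (det_xx a * (t 0 1)\<^sup>2 + det_xy a * t 0 1 * t 1 1 + det_yy a * (t 1 1)\<^sup>2)"
    unfolding 1 2 3 \<kappa>_def by (simp_all add: mult.assoc)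
qed

text \<open>\<open>\<kappa>\<close> is the product of the determinants of \<open>R\<close> and
  \<open>S\<close>; \<open>x\<close>, \<open>y\<close>, \<open>z\<close>, \<open>w\<close> are the
  entries of \<open>T\<close> row by row.\<close>

lemma equiv_222_det_form:
  assumes "equiv_smat (2, 2, 2, a) (2, 2, 2, b)"
  obtains \<kappa> x y z w where "\<kappa> \<noteq> 0" "x * w - y * z \<noteq> 0"
    "det_xx b = \<kappa> * (det_xx a * x\<^sup>2 + det_xy a * x * z + det_yy a * z\<^sup>2)"
    "det_xy b = \<kappa> * (2 * det_xx a * x * y + det_xy a * (x * w + y * z) + 2 * det_yy a * z * w)"
    "det_yy b = \<kappa> * (det_xx a * y\<^sup>2 + det_xy a * y * w + det_yy a * w\<^sup>2)"
proof -
  obtain R S T where RST: "R \<in> carrier_mat 2 2" "invertible_mat R"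
    "S \<in> carrier_mat 2 2" "invertible_mat S" "T \<in> carrier_mat 2 2" "invertible_mat T"
    and b: "\<And>i j k. i < 2 \<Longrightarrow> j < 2 \<Longrightarrow> k < 2 \<Longrightarrow> b i j k =
      act 2 2 2 (\<lambda>i i'. R $$ (i, i')) (\<lambda>i i'. S $$ (i, i')) (\<lambda>i i'. T $$ (i, i')) a i j k"
    using assms unfolding equiv_smat_eq by blast
  show ?thesis
    by (rule that[OF _ _ det_form_act[OF b]]) (use RST invertible_mat_2_det in auto)
qed

text \<open>An invariant that holds for form (5) but not for form (6).\<close>

definition degenerate_smat :: "('a::field) smat \<Rightarrow> bool" where
  "degenerate_smat A \<longleftrightarrow> (case A of (m, n, q, a) \<Rightarrow>
     (\<exists>c d. (\<exists>j<n. c j \<noteq> 0) \<and> (\<exists>k<q. d k \<noteq> 0) \<and>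
       (\<forall>i<m. (\<Sum>j<n. \<Sum>k<q. a i j k * c j * d k) = 0)))"

lemma invertible_mat_nonzero_image:
  fixes R :: "'a::field mat"
  assumes "R \<in> carrier_mat m m" "invertible_mat R" "\<exists>i<m. c i \<noteq> 0"
  shows "\<exists>i<m. (\<Sum>l<m. R $$ (i, l) * c l) \<noteq> 0"
proof (rule ccontr)
  assume "\<not> ?thesis"
  then have z: "(\<Sum>l<m. R $$ (x, l) * c l) = 0" if "x < m" for x using that by auto
  obtain R' where R':
    "\<And>i j. i < m \<Longrightarrow> j < m \<Longrightarrow> (\<Sum>l<m. R' $$ (i, l) * R $$ (l, j)) = (if i = j then 1 else 0)"
    using invertible_mat_inverse[OF assms(1,2)] by metis
  obtain i where i: "i < m" "c i \<noteq> 0" using assms by blast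
  have "0 = (\<Sum>x<m. R' $$ (i, x) * (\<Sum>l<m. R $$ (x, l) * c l))" by (simp add: z)
  also have "\<dots> = (\<Sum>l<m. (\<Sum>x<m. R' $$ (i, x) * R $$ (x, l)) * c l)"
    unfolding sum_distrib_left sum_distrib_right by (subst sum.swap) (simp add: mult.assoc)
  also have "\<dots> = (\<Sum>l<m. if i = l then c l else 0)"
    using i by (intro sum.cong) (auto simp: R')
  also have "\<dots> = c i" using i by simp
  finally show False using i by simp
qed

text \<open>If \<open>c\<close> and \<open>d\<close> annihilate every row of \<open>b\<close>, then
  \<open>S c\<close> and \<open>T d\<close> annihilate every row of \<open>a\<close>. Nonsingularity
  of \<open>S\<close> and \<open>T\<close> keeps them nonzero; that of \<open>R\<close> lets the
  vanishing pass back.\<close>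

lemma degenerate_if_equiv:
  assumes "equiv_smat A B" "degenerate_smat B"
  shows "degenerate_smat A"
proof -
  obtain m n q a where A: "A = (m, n, q, a)" by (cases A)
  obtain b where B: "B = (m, n, q, b)" using assms A by (auto simp: equiv_smat_def)
  obtain R S T where RST: "R \<in> carrier_mat m m" "invertible_mat R"
    "S \<in> carrier_mat n n" "invertible_mat S" "T \<in> carrier_mat q q" "invertible_mat T"
    and b: "\<And>i j k. i < m \<Longrightarrow> j < n \<Longrightarrow> k < q \<Longrightarrow> b i j k =
      act m n q (\<lambda>i i'. R $$ (i, i')) (\<lambda>i i'. S $$ (i, i')) (\<lambda>i i'. T $$ (i, i')) a i j k"
    using assms unfolding A B equiv_smat_eq by blast
  obtain c d where cd: "\<exists>j<n. c j \<noteq> 0" "\<exists>k<q. d k \<noteq> 0"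
    "\<And>i. i < m \<Longrightarrow> (\<Sum>j<n. \<Sum>k<q. b i j k * c j * d k) = 0"
    using assms(2) unfolding B degenerate_smat_def prod.case by blast
  define c' where "c' j = (\<Sum>l<n. S $$ (j, l) * c l)" for j
  define d' where "d' k = (\<Sum>l<q. T $$ (k, l) * d l)" for k
  define e where "e i = (\<Sum>j<n. \<Sum>k<q. a i j k * c' j * d' k)" for i
  \<comment> \<open>Contracting \<open>b\<close> with \<open>c\<close> and \<open>d\<close> gives
    the contraction \<open>e\<close> of \<open>a\<close> with \<open>S c\<close> and
    \<open>T d\<close>, multiplied by \<open>R\<close>.\<close>
  have *: "(\<Sum>j<n. \<Sum>k<q. b l j k * c j * d k) = (\<Sum>i<m. e i * R $$ (i, l))" if "l < m" for l
  proof -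
    let ?f = "\<lambda>x y z j k. a x y z * R $$ (x, l) * (S $$ (y, j) * c j) * (T $$ (z, k) * d k)"
    have "(\<Sum>j<n. \<Sum>k<q. b l j k * c j * d k) =
        (\<Sum>(j, k)\<in>{..<n} \<times> {..<q}. \<Sum>(x, y, z)\<in>{..<m} \<times> {..<n} \<times> {..<q}. ?f x y z j k)"
      unfolding sum.cartesian_product
      by (intro sum.cong refl)
        (auto simp: b that act_eq_sum_prod sum_distrib_left sum_distrib_right mult_ac intro!: sum.cong)
    also have "\<dots> = (\<Sum>(x, y, z)\<in>{..<m} \<times> {..<n} \<times> {..<q}. \<Sum>(j, k)\<in>{..<n} \<times> {..<q}. ?f x y z j k)"
      unfolding split_def by (rule sum.swap)
    also have "\<dots> = (\<Sum>(x, y, z)\<in>{..<m} \<times> {..<n} \<times> {..<q}. a x y z * R $$ (x, l) * c' y * d' z)"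
    proof (intro sum.cong refl, clarify)
      fix x y z
      have "(\<Sum>(j, k)\<in>{..<n} \<times> {..<q}. ?f x y z j k) = (\<Sum>j<n. \<Sum>k<q. ?f x y z j k)"
        by (simp add: sum.cartesian_product)
      also have "\<dots> = (\<Sum>j<n. a x y z * R $$ (x, l) * (S $$ (y, j) * c j) * d' z)"
        unfolding d'_def sum_distrib_left by simp
      also have "\<dots> = a x y z * R $$ (x, l) * c' y * d' z"
        unfolding c'_def sum_distrib_left sum_distrib_right by simp
      finally show "(\<Sum>(j, k)\<in>{..<n} \<times> {..<q}. ?f x y z j k) = a x y z * R $$ (x, l) * c' y * d' z" .
    qed
    also have "\<dots> = (\<Sum>x<m. \<Sum>y<n. \<Sum>z<q. a x y z * R $$ (x, l) * c' y * d' z)"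
      by (simp add: sum.cartesian_product)
    also have "\<dots> = (\<Sum>i<m. e i * R $$ (i, l))"
      unfolding e_def sum_distrib_right by (simp add: mult_ac)
    finally show ?thesis .
  qed
  obtain R' where R':
    "\<And>i j. i < m \<Longrightarrow> j < m \<Longrightarrow> (\<Sum>l<m. R $$ (i, l) * R' $$ (l, j)) = (if i = j then 1 else 0)"
    using invertible_mat_inverse[OF RST(1,2)] by metis
  have "e x = 0" if "x < m" for x
  proof -
    have "0 = (\<Sum>l<m. (\<Sum>i<m. e i * R $$ (i, l)) * R' $$ (l, x))"
      using cd(3) * by simp
    also have "\<dots> = (\<Sum>i<m. e i * (\<Sum>l<m. R $$ (i, l) * R' $$ (l, x)))"
      unfolding sum_distrib_left sum_distrib_right by (subst sum.swap) (simp add: mult.assoc)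
    also have "\<dots> = (\<Sum>i<m. if i = x then e i else 0)"
      using that by (intro sum.cong) (auto simp: R')
    also have "\<dots> = e x" using that by simp
    finally show ?thesis by simp
  qed
  moreover have "\<exists>j<n. c' j \<noteq> 0" "\<exists>k<q. d' k \<noteq> 0"
    unfolding c'_def d'_def
    using invertible_mat_nonzero_image[OF RST(3,4) cd(1)]
      invertible_mat_nonzero_image[OF RST(5,6) cd(2)] by auto
  ultimately show ?thesis
    unfolding A degenerate_smat_def prod.case e_def by blast
qed

lemma degenerate_C5: "degenerate_smat (canon_smat C5)"
  unfolding degenerate_smat_def canon_smat.simps of_slices_def prod.case
  \<comment> \<open>The unit vectors select the first column of the second slice, which is
    zero.\<close>
  by (intro exI[of _ "\<lambda>j. if j = 0 then 1 else 0"] exI[of _ "\<lambda>k. if k = 0 then 0 else 1"])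
    (auto simp: numeral_eq_Suc All_less_Suc)

text \<open>The three equations say that the polynomial product
  \<open>(c 0 + c 1 t) (d 0 + d 1 t)\<close> vanishes, so one factor does.\<close>

lemma not_degenerate_C6: "\<not> degenerate_smat (canon_smat C6)"
proof
  assume "degenerate_smat (canon_smat C6 :: 'a smat)"
  then obtain c d :: "nat \<Rightarrow> 'a" where "c 0 \<noteq> 0 \<or> c 1 \<noteq> 0" "d 0 \<noteq> 0 \<or> d 1 \<noteq> 0"
    "c 0 * d 0 = 0" "c 1 * d 0 + c 0 * d 1 = 0" "c 1 * d 1 = 0"
    by (simp add: degenerate_smat_def of_slices_def numeral_eq_Suc All_less_Suc Ex_less_Suc)
      (metis add.commute)
  then show False by auto
qed

section \<open>Arithmetic in characteristic two\<close>

lemma two_eq_0_iff_CHAR: "(2 :: 'a::field) = 0 \<longleftrightarrow> CHAR('a) = 2"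
proof
  assume "(2 :: 'a) = 0"
  then have "of_nat 2 = (0 :: 'a)" by simp
  then have "CHAR('a) dvd 2" by (simp only: of_nat_eq_0_iff_char_dvd)
  then have "CHAR('a) \<le> 2" "CHAR('a) \<noteq> 0"
    by (auto dest: dvd_imp_le intro!: Nat.gr0I simp del: CHAR_pos_iff)
  moreover have "CHAR('a) \<noteq> 1" by simp
  ultimately show "CHAR('a) = 2" by linarith
next
  assume "CHAR('a) = 2"
  then have "of_nat 2 = (0 :: 'a)" by (simp only: of_nat_eq_0_iff_char_dvd dvd_refl)
  then show "(2 :: 'a) = 0" by simp
qed

lemma char_2_simps:
  fixes x y :: "'a::field"
  assumes "(2 :: 'a) = 0"
  shows "x + x = 0" "x + (x + y) = y" "- x = x" "x - y = x + y" 
proof -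
  show 1: "x + x = 0" for x :: 'a using assms by (metis mult_2 mult_zero_left)
  show 2: "- x = x" for x :: 'a using 1[of x] by (metis add_eq_0_iff)
  show "x + (x + y) = y" using 1 by (simp flip: add.assoc)
  show "x - y = x + y" using 2[of y] by (metis diff_conv_add_uminus)
qed

section \<open>Explicit equivalences among the 2 x 2 x 2 forms\<close>

lemma CA_transforms_scale:
  assumes "(c :: 'a::field) \<noteq> 0"
  shows "transforms_to (canon_smat (CA v)) (canon_smat (CA (v * c\<^sup>2)))"
proof -
  have "transforms_to (canon_smat (CA v)) (pencil 1 0 0 1 0 v 1 0)"
    by (rule canon_transforms_to_pencil)
  also have "transforms_to (pencil 1 0 0 1 0 v 1 0) (pencil 1 0 0 1 0 (c * v) c 0)"
    using pencil_slices[where a = 1 and b = 0 and c = 0 and d = c, of 1 0 0 1 0 v 1 0] by simp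
  also have "transforms_to (pencil 1 0 0 1 0 (c * v) c 0) (pencil 1 0 0 (1 / c) 0 (c * v) 1 0)"
    using pencil_rows[where a = 1 and b = 0 and c = 0 and d = "1 / c", of 1 0 0 1 0 "c * v" c 0]
      assms by simp
  also have "transforms_to (pencil 1 0 0 (1 / c) 0 (c * v) 1 0) (pencil 1 0 0 1 0 (v * c\<^sup>2) 1 0)"
    using pencil_columns[where a = 1 and b = 0 and c = 0 and d = c, of 1 0 0 "1 / c" 0 "c * v" 1 0]
      assms by (simp add: power2_eq_square mult_ac)
  also note pencil_transforms_to_canon(1)
  finally show ?thesis .
qed

text \<open>Let \<open>\<omega>\<close> be the second slice, so \<open>\<omega>^2 = v\<close>. The
  slice change gives multiplication by \<open>A = a + c \<omega>\<close> and
  \<open>B = b + d \<omega>\<close>. In characteristic two \<open>A^2\<close> and \<open>B^2\<close>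
  are scalars. From the basis \<open>1, B / A\<close> to the basis \<open>A, B\<close> the slices
  become the identity and the companion matrix of \<open>B / A\<close>.\<close>

lemma CA_transforms_moebius:
  fixes a b c d v :: "'a::field"
  assumes 2: "(2 :: 'a) = 0" and nz: "a * d + b * c \<noteq> 0" "a\<^sup>2 + v * c\<^sup>2 \<noteq> 0"
  shows "transforms_to (canon_smat (CA v)) (canon_smat (CA ((b\<^sup>2 + v * d\<^sup>2) / (a\<^sup>2 + v * c\<^sup>2))))"
proof -
  define l where "l = a\<^sup>2 + v * c\<^sup>2"
  define u where "u = (b\<^sup>2 + v * d\<^sup>2) / l"
  define D where "D = a * d + b * c"
  have l: "l \<noteq> 0" and D: "D \<noteq> 0" using nz by (auto simp: l_def D_def)
  \<comment> \<open>\<open>f + g \<omega>\<close> is \<open>B / A = A B / A^2\<close> for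
    \<open>A = a + c \<omega>\<close> and \<open>B = b + d \<omega>\<close>. The identities
    \<open>col\<close> are \<open>A (B / A) = B\<close> and \<open>B (B / A) = u A\<close> in
    coordinates.\<close>
  define f g where "f = (a * b + v * c * d) / l" and "g = D / l"
  note ch = char_2_simps[OF 2]
  have col: "f * a + g * (v * c) = b" "f * c + g * a = d" "f * b + g * (v * d) = u * a"
    "f * d + g * b = u * c"
  proof -
    have "a * (a * b + v * c * d) + D * (v * c) = b * l"
      using ch by (simp add: D_def l_def algebra_simps power2_eq_square)
    then show "f * a + g * (v * c) = b" using l by (simp add: f_def g_def field_simps)
    have "c * (a * b + v * c * d) + D * a = d * l"
      using ch by (simp add: D_def l_def algebra_simps power2_eq_square)
    then show "f * c + g * a = d" using l by (simp add: f_def g_def field_simps)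
    have "b * (a * b + v * c * d) + D * (v * d) = (b\<^sup>2 + v * d\<^sup>2) * a"
      using ch by (simp add: D_def l_def algebra_simps power2_eq_square)
    then show "f * b + g * (v * d) = u * a" using l by (simp add: f_def g_def u_def field_simps)
    have "d * (a * b + v * c * d) + D * b = (b\<^sup>2 + v * d\<^sup>2) * c"
      using ch by (simp add: D_def l_def algebra_simps power2_eq_square)
    then show "f * d + g * b = u * c" using l by (simp add: f_def g_def u_def field_simps)
  qed
  have row: "d / D * a + b / D * c = 1" "d / D * b + b / D * d = 0" "c / D * a + a / D * c = 0"
    "c / D * b + a / D * d = 1" "d / D * (u * a) + b / D * (u * c) = u"
    "c / D * (u * a) + a / D * (u * c) = 0"
  proof -
    show "d / D * a + b / D * c = 1" "c / D * b + a / D * d = 1"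
      using D by (simp_all add: D_def algebra_simps flip: add_divide_distrib)
    show "d / D * b + b / D * d = 0" "c / D * a + a / D * c = 0"
      "c / D * (u * a) + a / D * (u * c) = 0"
      using ch by (simp_all add: mult_ac)
    have "d / D * (u * a) + b / D * (u * c) = u * (d / D * a + b / D * c)"
      by (simp add: algebra_simps)
    then show "d / D * (u * a) + b / D * (u * c) = u"
      unfolding \<open>d / D * a + b / D * c = 1\<close> by simp
  qed
  have "transforms_to (canon_smat (CA v)) (pencil 1 0 0 1 0 v 1 0)"
    by (rule canon_transforms_to_pencil)
  also have "transforms_to (pencil 1 0 0 1 0 v 1 0) (pencil a (v * c) c a b (v * d) d b)"
    using pencil_slices[where a = a and b = b and c = c and d = d, of 1 0 0 1 0 v 1 0]
    by (simp add: mult_ac)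
  also have "transforms_to (pencil a (v * c) c a b (v * d) d b)
      (pencil a b c d b (u * a) d (u * c))"
    using pencil_columns[where a = 1 and b = f and c = 0 and d = g,
        of a "v * c" c a b "v * d" d b] by (simp add: col)
  \<comment> \<open>The row change is the inverse of the first slice; in characteristic two its
    determinant is \<open>D\<close> and no signs occur.\<close>
  also have "transforms_to (pencil a b c d b (u * a) d (u * c)) (pencil 1 0 0 1 0 u 1 0)"
    using pencil_rows[where a = "d / D" and b = "c / D" and c = "b / D" and d = "a / D",
        of a b c d b "u * a" d "u * c"] unfolding row .
  also note pencil_transforms_to_canon(1)
  finally show ?thesis unfolding u_def l_def .
qed

text \<open>The second slice satisfies \<open>\<omega>^2 = \<omega> + v\<close>, hence
  \<open>(\<omega> + b)^2 = (\<omega> + b) + (v + b + b^2)\<close>. A unipotent conjugation brings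
  \<open>\<omega> + b\<close> to companion shape.\<close>

lemma CB_transforms_shift:
  fixes b v :: "'a::field"
  assumes 2: "(2 :: 'a) = 0"
  shows "transforms_to (canon_smat (CB v)) (canon_smat (CB (v + b + b\<^sup>2)))"
proof -
  note ch = char_2_simps[OF 2]
  have "transforms_to (canon_smat (CB v)) (pencil 1 0 0 1 0 v 1 1)"
    by (rule canon_transforms_to_pencil)
  also have "transforms_to (pencil 1 0 0 1 0 v 1 1) (pencil 1 0 0 1 b v 1 (b + 1))"
    using pencil_slices[where a = 1 and b = b and c = 0 and d = 1, of 1 0 0 1 0 v 1 1] by simp
  also have "transforms_to (pencil 1 0 0 1 b v 1 (b + 1)) (pencil 1 b 0 1 0 (v + b + b\<^sup>2) 1 (b + 1))"
    using pencil_rows[where a = 1 and b = 0 and c = b and d = 1, of 1 0 0 1 b v 1 "b + 1"] ch(1)[of b]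
    by (simp add: algebra_simps power2_eq_square)
  also have "transforms_to (pencil 1 b 0 1 0 (v + b + b\<^sup>2) 1 (b + 1))
      (pencil 1 0 0 1 0 (v + b + b\<^sup>2) 1 1)"
    using pencil_columns[where a = 1 and b = b and c = 0 and d = 1,
        of 1 b 0 1 0 "v + b + b\<^sup>2" 1 "b + 1"] ch(1,2)
    by simp
  also note pencil_transforms_to_canon(2)
  finally show ?thesis .
qed

text \<open>The second slice has eigenvalues \<open>w\<close> and \<open>- w\<close>. The slice
  change produces the two spectral projections, the column change passes to eigenvectors, and the
  row change inverts the eigenvector matrix.\<close>

lemma CA_transforms_CD:
  fixes w :: "'a::field"
  assumes "(2 :: 'a) \<noteq> 0" "w \<noteq> 0"
  shows "transforms_to (canon_smat (CA (w\<^sup>2))) (canon_smat CD)"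
proof -
  have h: "x / 2 + x / 2 = x" for x :: 'a using assms(1) by (simp flip: mult_2)
  have h1: "1 / 2 + 1 / 2 = (1 :: 'a)" using h[of 1] .
  have "transforms_to (canon_smat (CA (w\<^sup>2))) (pencil 1 0 0 1 0 (w\<^sup>2) 1 0)"
    by (rule canon_transforms_to_pencil)
  also have "transforms_to (pencil 1 0 0 1 0 (w\<^sup>2) 1 0)
      (pencil (1 / 2) (w / 2) (1 / (2 * w)) (1 / 2) (1 / 2) (- w / 2) (- 1 / (2 * w)) (1 / 2))"
    using pencil_slices[where a = "1 / 2" and b = "1 / 2" and c = "1 / (2 * w)" and d = "- 1 / (2 * w)",
      of 1 0 0 1 0 "w\<^sup>2" 1 0] assms by (simp add: power2_eq_square)
  also have "transforms_to
      (pencil (1 / 2) (w / 2) (1 / (2 * w)) (1 / 2) (1 / 2) (- w / 2) (- 1 / (2 * w)) (1 / 2))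
      (pencil w 0 1 0 0 (- w) 0 1)"
    using pencil_columns[where a = w and b = "- w" and c = 1 and d = 1, of "1 / 2" "w / 2"
      "1 / (2 * w)" "1 / 2" "1 / 2" "- w / 2" "- 1 / (2 * w)" "1 / 2"] assms h h1 h[of "- w"]
    by simp
  also have "transforms_to (pencil w 0 1 0 0 (- w) 0 1) (pencil 1 0 0 0 0 0 0 1)"
    using pencil_rows[where a = "1 / (2 * w)" and b = "- 1 / (2 * w)" and c = "1 / 2" and d = "1 / 2",
      of w 0 1 0 0 "- w" 0 1] assms h1 by simp
  also note pencil_transforms_to_canon(3)
  finally show ?thesis .
qed

text \<open>For \<open>v = 0\<close> the second slice is an idempotent \<open>e\<close>, in every
  characteristic; \<open>1 - e\<close> and \<open>e\<close> are diagonalised together.\<close>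

lemma CB_0_transforms_CD: "transforms_to (canon_smat (CB 0)) (canon_smat CD :: 'a::field smat)"
proof -
  have "transforms_to (canon_smat (CB 0)) (pencil 1 0 0 1 0 0 1 (1 :: 'a))"
    by (rule canon_transforms_to_pencil)
  also have "transforms_to (pencil 1 0 0 1 0 0 1 1) (pencil 1 0 (- 1) 0 0 0 1 (1 :: 'a))"
    using pencil_slices[where a = 1 and b = 0 and c = "- 1" and d = 1, of 1 0 0 1 0 0 1 "1 :: 'a"]
    by simp
  also have "transforms_to (pencil 1 0 (- 1) 0 0 0 1 1) (pencil 1 0 0 0 0 0 1 (1 :: 'a))"
    using pencil_rows[where a = 1 and b = 1 and c = 0 and d = 1, of 1 0 "- 1" 0 0 0 1 "1 :: 'a"]
    by simp
  also have "transforms_to (pencil 1 0 0 0 0 0 1 1) (pencil 1 0 0 0 0 0 0 (1 :: 'a))"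
    using pencil_columns[where a = 1 and b = 0 and c = "- 1" and d = 1, of 1 0 0 0 0 0 1 "1 :: 'a"]
    by simp
  also note pencil_transforms_to_canon(3)
  finally show ?thesis .
qed

section \<open>Telling the 2 x 2 x 2 forms apart\<close>

lemma canon_smat_222:
  "\<exists>a. canon_smat (CA v) = (2, 2, 2, a) \<and> det_xx a = 1 \<and> det_xy a = 0 \<and> det_yy a = - v"
  "\<exists>a. canon_smat (CB v) = (2, 2, 2, a) \<and> det_xx a = 1 \<and> det_xy a = 1 \<and> det_yy a = - v"
  "\<exists>a. canon_smat CD = (2, 2, 2, a) \<and> det_xx a = 0 \<and> det_xy a = 1 \<and> det_yy a = (0 :: 'a::field)"
  for v :: "'a::field"
  by (simp_all add: of_slices_def det_xx_def det_xy_def det_yy_def)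

text \<open>The forms compared are \<open>x^2 - v y^2\<close> and \<open>x^2 - v' y^2\<close>. In
  characteristic two the mixed coefficient vanishes automatically and the ratio of the other two is
  a Moebius map with square coefficients; otherwise its vanishing is a genuine condition.\<close>

lemma equiv_CA_CA:
  fixes v v' :: "'a::field"
  assumes "equiv_smat (canon_smat (CA v)) (canon_smat (CA v'))"
  shows "canon_rel (CA v) (CA v')"
proof -
  obtain a where a: "canon_smat (CA v) = (2, 2, 2, a)" "det_xx a = 1" "det_xy a = 0" "det_yy a = - v"
    using canon_smat_222(1)[of v] by blast
  obtain b where b: "canon_smat (CA v') = (2, 2, 2, b)" "det_xx b = 1" "det_xy b = 0" "det_yy b = - v'"
    using canon_smat_222(1)[of v'] by blast
  obtain k x y z w where k: "k \<noteq> 0" and D: "x * w - y * z \<noteq> 0"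
    and 1: "1 = k * (x\<^sup>2 - v * z\<^sup>2)" and 2: "0 = k * (2 * (x * y - v * z * w))"
    and 3: "- v' = k * (y\<^sup>2 - v * w\<^sup>2)"
    by (rule equiv_222_det_form[OF assms[unfolded a b]]) (simp add: a b right_diff_distrib mult.assoc)
  show ?thesis
  proof (cases "CHAR('a) = 2")
    case False
    then have "x * y = v * z * w" using 2 k by (simp flip: two_eq_0_iff_CHAR)
    then have sq: "(x * y - v * z * w)\<^sup>2 = 0" by simp
    \<comment> \<open>The factor \<open>1 = k * (x^2 - v z^2)\<close> is inserted to apply
      Brahmagupta's identity, in which one of the two squares is \<open>sq\<close>.\<close>
    have "v' = (k * (x\<^sup>2 - v * z\<^sup>2)) * (k * (v * w\<^sup>2 - y\<^sup>2))"
      using 1 minus_equation_iff[of v' "k * (y\<^sup>2 - v * w\<^sup>2)"] 3 by (simp flip: mult_minus_right)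
    also have "\<dots> = k\<^sup>2 * (v * (x * w - y * z)\<^sup>2 - (x * y - v * z * w)\<^sup>2)"
      by (simp add: algebra_simps power2_eq_square)
    also have "\<dots> = v * (k * (x * w - y * z))\<^sup>2"
      unfolding sq by (simp add: power_mult_distrib)
    finally show ?thesis using False k D unfolding canon_rel_def is_square_def
      by (simp, intro exI[of _ "(k * (x * w - y * z))\<^sup>2"]) auto
  next
    case True
    then have ch: "(2 :: 'a) = 0" by (simp add: two_eq_0_iff_CHAR)
    note ch = char_2_simps[OF this]
    have nz: "x\<^sup>2 + v * z\<^sup>2 \<noteq> 0" using 1 ch(4) by auto
    then have "z\<^sup>2 * v + x\<^sup>2 \<noteq> 0" by (simp add: add.commute mult.commute)
    moreover have squares: "is_square (c\<^sup>2)" for c :: 'a by (auto simp: is_square_def)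
    moreover have "v' = (w\<^sup>2 * v + y\<^sup>2) / (z\<^sup>2 * v + x\<^sup>2)"
    proof -
      have "v' * (x\<^sup>2 + v * z\<^sup>2) = k * (x\<^sup>2 + v * z\<^sup>2) * (y\<^sup>2 + v * w\<^sup>2)"
        using 3 ch by (simp add: mult_ac)
      also have "\<dots> = y\<^sup>2 + v * w\<^sup>2" using 1 ch(4) by simp
      finally show ?thesis using nz by (simp add: field_simps)
    qed
    moreover have "w\<^sup>2 * x\<^sup>2 + y\<^sup>2 * z\<^sup>2 \<noteq> 0"
    proof -
      have "w\<^sup>2 * x\<^sup>2 + y\<^sup>2 * z\<^sup>2 = (x * w - y * z)\<^sup>2"
        using ch by (simp add: algebra_simps power2_eq_square)
      then show ?thesis using D by simp
    qed
    ultimately have "\<exists>u u' \<alpha> \<beta> \<gamma> \<delta>. CA v = CA u \<and> CA v' = CA u' \<and> is_square \<alpha> \<and> is_square \<beta> \<and>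
        is_square \<gamma> \<and> is_square \<delta> \<and> \<alpha> * \<delta> + \<beta> * \<gamma> \<noteq> 0 \<and> \<gamma> * u + \<delta> \<noteq> 0 \<and>
        u' = (\<alpha> * u + \<beta>) / (\<gamma> * u + \<delta>)"
      by (intro exI[of _ v] exI[of _ v'] exI[of _ "w\<^sup>2"] exI[of _ "y\<^sup>2"] exI[of _ "z\<^sup>2"]
          exI[of _ "x\<^sup>2"] conjI refl squares)
    then show ?thesis using True by (simp add: canon_rel_def)
  qed
qed

lemma equiv_CB_CB:
  fixes v v' :: "'a::field"
  assumes "equiv_smat (canon_smat (CB v)) (canon_smat (CB v'))" "CHAR('a) = 2"
  shows "canon_rel (CB v) (CB v')"
proof -
  have "(2 :: 'a) = 0" using assms by (simp add: two_eq_0_iff_CHAR)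
  note ch = char_2_simps[OF this] this
  obtain a where a: "canon_smat (CB v) = (2, 2, 2, a)" "det_xx a = 1" "det_xy a = 1" "det_yy a = - v"
    using canon_smat_222(2)[of v] by blast
  obtain b where b: "canon_smat (CB v') = (2, 2, 2, b)" "det_xx b = 1" "det_xy b = 1" "det_yy b = - v'"
    using canon_smat_222(2)[of v'] by blast
  obtain k x y z w where k: "k \<noteq> 0" and D: "x * w - y * z \<noteq> 0"
    and 1: "1 = k * (x\<^sup>2 + x * z + v * z\<^sup>2)" and 2: "1 = k * (x * w + y * z)"
    and 3: "v' = k * (y\<^sup>2 + y * w + v * w\<^sup>2)"
    by (rule equiv_222_det_form[OF assms(1)[unfolded a b]]) (use ch in \<open>simp add: a b\<close>)
  \<comment> \<open>\<open>p + l \<omega>\<close> is the product to which the norm identity below is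
    applied. By \<open>1\<close> and \<open>2\<close>, \<open>l\<close> is also the norm of
    \<open>x + z \<omega>\<close>.\<close>
  define l where "l = x * w + y * z"
  define p where "p = (x + z) * y + z * w * v"
  have kl: "k * l = 1" using 2 by (simp add: l_def)
  have l: "l = x\<^sup>2 + x * z + v * z\<^sup>2" using 1 2 k unfolding l_def by (metis mult_left_cancel)
  \<comment> \<open>Multiplicativity of the norm \<open>N(s + t\<omega>) = s\<^sup>2 + s t + v t\<^sup>2\<close>, where \<open>\<omega>\<^sup>2 = \<omega> - v\<close>,
    applied to the conjugate of \<open>x + z\<omega>\<close> and \<open>y + w\<omega>\<close>.\<close>
  have "(x\<^sup>2 + x * z + v * z\<^sup>2) * (y\<^sup>2 + y * w + v * w\<^sup>2) =
      p\<^sup>2 + p * (x * w - y * z) + v * (x * w - y * z)\<^sup>2"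
    by (simp add: p_def algebra_simps power2_eq_square)
  also have "x * w - y * z = l" using ch by (simp add: l_def)
  finally have norm: "(x\<^sup>2 + x * z + v * z\<^sup>2) * (y\<^sup>2 + y * w + v * w\<^sup>2) = p\<^sup>2 + p * l + v * l\<^sup>2" .
  \<comment> \<open>Inserting the factor \<open>1\<close> from the first coefficient makes
    \<open>k\<close> occur squared; with \<open>k * l = 1\<close> the shift is then
    \<open>\<beta> = k * p\<close>.\<close>
  have "v' = (k * (x\<^sup>2 + x * z + v * z\<^sup>2)) * (k * (y\<^sup>2 + y * w + v * w\<^sup>2))"
    unfolding 1[symmetric] 3 by simp
  also have "\<dots> = k * k * (p\<^sup>2 + p * l + v * l\<^sup>2)"
    unfolding norm[symmetric] by (simp only: mult_ac)
  also have "\<dots> = v * (k * l)\<^sup>2 + (k * p) * (k * l) + (k * p)\<^sup>2"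
    by (simp add: algebra_simps power2_eq_square)
  finally have "v' = v + k * p + (k * p)\<^sup>2" by (simp add: kl)
  then show ?thesis using assms(2) by (auto simp: canon_rel_def)
qed

text \<open>In characteristic two a zero mixed coefficient stays zero, since the other contributions
  to it carry a factor 2; for \<open>CB\<close> it is 1.\<close>

lemma not_equiv_CA_CB:
  fixes v v' :: "'a::field"
  assumes "CHAR('a) = 2"
  shows "\<not> equiv_smat (canon_smat (CA v)) (canon_smat (CB v'))"
proof
  assume e: "equiv_smat (canon_smat (CA v)) (canon_smat (CB v'))"
  have "(2 :: 'a) = 0" using assms by (simp add: two_eq_0_iff_CHAR)
  obtain a where a: "canon_smat (CA v) = (2, 2, 2, a)" "det_xx a = 1" "det_xy a = 0" "det_yy a = - v"
    using canon_smat_222(1)[of v] by blast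
  obtain b where b: "canon_smat (CB v') = (2, 2, 2, b)" "det_xx b = 1" "det_xy b = 1" "det_yy b = - v'"
    using canon_smat_222(2)[of v'] by blast
  show False
    by (rule equiv_222_det_form[OF e[unfolded a b]]) (use \<open>(2 :: 'a) = 0\<close> in \<open>simp add: a b\<close>)
qed

text \<open>The form of \<open>CA 0\<close> is \<open>x^2\<close>, that of \<open>CD\<close> is
  \<open>x y\<close>. Vanishing of both pure coefficients would make the first row of
  \<open>T\<close> zero.\<close>

lemma not_equiv_CA_0_CD: "\<not> equiv_smat (canon_smat (CA 0)) (canon_smat CD :: 'a::field smat)"
proof
  assume e: "equiv_smat (canon_smat (CA 0)) (canon_smat CD :: 'a smat)"
  obtain a where a: "canon_smat (CA 0) = (2, 2, 2, a)" "det_xx a = 1" "det_xy a = 0"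
      "det_yy a = (0 :: 'a)"
    using canon_smat_222(1)[of 0] by auto
  obtain b where b: "canon_smat CD = (2, 2, 2, b)" "det_xx b = 0" "det_xy b = 1" "det_yy b = (0 :: 'a)"
    using canon_smat_222(3) by blast
  show False
    by (rule equiv_222_det_form[OF e[unfolded a b]]) (auto simp: a b)
qed

section \<open>Reduction to canonical form\<close>

lemma regular_smatD:
  assumes "regular_smat (m, n, q, a)"
  shows "(\<And>i j. i < m \<Longrightarrow> j < n \<Longrightarrow> (\<Sum>k<q. c k * a i j k) = 0) \<Longrightarrow> k < q \<Longrightarrow> c k = 0"
    and "(\<And>i k. i < m \<Longrightarrow> k < q \<Longrightarrow> (\<Sum>j<n. c j * a i j k) = 0) \<Longrightarrow> j < n \<Longrightarrow> c j = 0"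
    and "(\<And>j k. j < n \<Longrightarrow> k < q \<Longrightarrow> (\<Sum>i<m. c i * a i j k) = 0) \<Longrightarrow> i < m \<Longrightarrow> c i = 0"
  using assms unfolding regular_smat_def by simp_all

lemma canon_if_transforms:
  assumes "transforms_to A B" "\<exists>f\<in>F. transforms_to B (canon_smat f)"
  shows "\<exists>f\<in>F. transforms_to A (canon_smat f)"
  using assms transforms_to_trans by blast

text \<open>Each bound counts the slices of one direction against their entries; too many slices
  would be dependent.\<close>

lemma regular_smat_dims:
  fixes a :: "nat \<Rightarrow> nat \<Rightarrow> nat \<Rightarrow> 'a::field"
  assumes "regular_smat (m, n, q, a)"
  shows "m \<le> n * q" "n \<le> m * q" "q \<le> m * n"
proof -
  show "m \<le> n * q"
  proof (rule ccontr)
    assume "\<not> m \<le> n * q"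
    then have "\<exists>c. (\<exists>i\<in>{..<m}. c i \<noteq> 0) \<and>
        (\<forall>p\<in>{..<n} \<times> {..<q}. (\<Sum>i\<in>{..<m}. c i * (case p of (j, k) \<Rightarrow> a i j k)) = 0)"
      by (intro nontrivial_relation) auto
    then show False using assms unfolding regular_smat_def by fastforce
  qed
  show "n \<le> m * q"
  proof (rule ccontr)
    assume "\<not> n \<le> m * q"
    then have "\<exists>c. (\<exists>j\<in>{..<n}. c j \<noteq> 0) \<and>
        (\<forall>p\<in>{..<m} \<times> {..<q}. (\<Sum>j\<in>{..<n}. c j * (case p of (i, k) \<Rightarrow> a i j k)) = 0)"
      by (intro nontrivial_relation) auto
    then show False using assms unfolding regular_smat_def by fastforce
  qed
  show "q \<le> m * n"
  proof (rule ccontr)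
    assume "\<not> q \<le> m * n"
    then have "\<exists>c. (\<exists>k\<in>{..<q}. c k \<noteq> 0) \<and>
        (\<forall>p\<in>{..<m} \<times> {..<n}. (\<Sum>k\<in>{..<q}. c k * (case p of (i, j) \<Rightarrow> a i j k)) = 0)"
      by (intro nontrivial_relation) auto
    then show False using assms unfolding regular_smat_def by fastforce
  qed
qed

lemma transforms_to_rows:
  assumes b: "\<And>i' j k. i' < m \<Longrightarrow> j < n \<Longrightarrow> k < q \<Longrightarrow> b i' j k = (\<Sum>i<m. a i j k * r i i')"
  shows "transforms_to (m, n, q, a) (m, n, q, b :: nat \<Rightarrow> nat \<Rightarrow> nat \<Rightarrow> 'a::field)"
proof -
  have 1: "x * (if P then 1 else 0) * y = (if P then x * y else 0)" for x y :: 'a and P by simp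
  have 2: "x * (if P then 1 else 0) = (if P then x else 0)" for x :: 'a and P by simp
  show ?thesis
    by (rule transforms_toI[where r = r and s = "\<lambda>i i'. if i = i' then 1 else 0"
          and t = "\<lambda>i i'. if i = i' then 1 else 0"])
      (simp add: act_def 1 2 b)
qed

text \<open>A row is here a slice with fixed first index. \<open>dep\<close> phrases membership in
  the span of the rows of \<open>a\<close> as a dependence, which dimension counts can
  supply.\<close>

lemma transforms_to_if_row_spans:
  fixes a b :: "nat \<Rightarrow> nat \<Rightarrow> nat \<Rightarrow> 'a::field"
  assumes reg: "regular_smat (m, n, q, a)"
    and dep: "\<And>i'. i' < m \<Longrightarrow> \<exists>c. (\<exists>i\<in>{..<Suc m}. c i \<noteq> 0)
      \<and> (\<forall>p\<in>{..<n} \<times> {..<q}. (\<Sum>i\<in>{..<Suc m}.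
          c i * (if i < m then case p of (j, k) \<Rightarrow> a i j k else case p of (j, k) \<Rightarrow> b i' j k)) = 0)"
  shows "transforms_to (m, n, q, a) (m, n, q, b)"
proof -
  have indep: "\<forall>i<m. c i = 0"
    if "\<forall>p\<in>{..<n} \<times> {..<q}. (\<Sum>i<m. c i * (case p of (j, k) \<Rightarrow> a i j k)) = 0" for c
    using reg that unfolding regular_smat_def by fastforce
  have "\<exists>r. \<forall>p\<in>{..<n} \<times> {..<q}. (case p of (j, k) \<Rightarrow> b i' j k) =
      (\<Sum>i<m. (case p of (j, k) \<Rightarrow> a i j k) * r i)" if "i' < m" for i'
    by (rule in_span_if_dependent[OF indep dep[OF that]])
  then obtain r where "\<And>i' p. i' < m \<Longrightarrow> p \<in> {..<n} \<times> {..<q} \<Longrightarrow> (case p of (j, k) \<Rightarrow> b i' j k) =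
      (\<Sum>i<m. (case p of (j, k) \<Rightarrow> a i j k) * r i' i)"
    by metis
  from this[of _ "(_, _)"] show ?thesis
    by (intro transforms_to_rows[where r = "\<lambda>i i'. r i' i"]) simp
qed

lemma transforms_to_if_full:
  assumes "regular_smat (m, n, q, a)" "m = n * q"
  shows "transforms_to (m, n, q, a) (m, n, q, b)"
  using assms by (intro transforms_to_if_row_spans nontrivial_relation) auto

text \<open>Both row spaces lie in the hyperplane orthogonal to \<open>N\<close>. Its dimension is
  \<open>m\<close>, so the independent rows of \<open>a\<close> span it.\<close>

lemma transforms_to_if_hyperplane:
  fixes a b :: "nat \<Rightarrow> nat \<Rightarrow> nat \<Rightarrow> 'a::field"
  assumes "regular_smat (m, n, q, a)" "Suc m = n * q"
    and N: "\<exists>p\<in>{..<n} \<times> {..<q}. N p \<noteq> 0"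
    and a: "\<And>i. i < m \<Longrightarrow> (\<Sum>p\<in>{..<n} \<times> {..<q}. (case p of (j, k) \<Rightarrow> a i j k) * N p) = 0"
    and b: "\<And>i. i < m \<Longrightarrow> (\<Sum>p\<in>{..<n} \<times> {..<q}. (case p of (j, k) \<Rightarrow> b i j k) * N p) = 0"
  shows "transforms_to (m, n, q, a) (m, n, q, b)"
  using assms(1)
proof (rule transforms_to_if_row_spans)
  fix i' assume "i' < m"
  show "\<exists>c. (\<exists>i\<in>{..<Suc m}. c i \<noteq> 0)
      \<and> (\<forall>p\<in>{..<n} \<times> {..<q}. (\<Sum>i\<in>{..<Suc m}.
          c i * (if i < m then case p of (j, k) \<Rightarrow> a i j k else case p of (j, k) \<Rightarrow> b i' j k)) = 0)"
  proof (rule nontrivial_relation_in_hyperplane[OF _ _ _ N])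
    fix i assume "i \<in> {..<Suc m}"
    show "(\<Sum>p\<in>{..<n} \<times> {..<q}.
        (if i < m then case p of (j, k) \<Rightarrow> a i j k else case p of (j, k) \<Rightarrow> b i' j k) * N p) = 0"
      by (cases "i < m") (simp_all only: if_True if_False a b \<open>i' < m\<close>)
  qed (use assms in auto)
qed

section \<open>The 2 x 2 x 2 format\<close>

lemma common_orthogonal:
  fixes u1 u2 w1 w2 :: "'a::field"
  assumes "u1 * w2 = u2 * w1"
  obtains c1 c2 where "c1 \<noteq> 0 \<or> c2 \<noteq> 0" "c1 * u1 + c2 * u2 = 0" "c1 * w1 + c2 * w2 = 0"
proof (cases "u1 = 0 \<and> u2 = 0")
  case True
  show ?thesis
  proof (cases "w1 = 0 \<and> w2 = 0")
    case True
    then show ?thesis using \<open>u1 = 0 \<and> u2 = 0\<close> by (intro that[of 1 0]) auto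
  next
    case False
    then show ?thesis using \<open>u1 = 0 \<and> u2 = 0\<close> by (intro that[of "- w2" w1]) auto
  qed
next
  case False
  then show ?thesis using assms by (intro that[of "- u2" u1]) auto
qed

lemma rank_one_factor:
  fixes x y z w :: "'a::field"
  assumes "x * w = y * z"
  obtains u1 u2 v1 v2 where "x = u1 * v1" "y = u1 * v2" "z = u2 * v1" "w = u2 * v2"
proof (cases "x = 0")
  case True
  show ?thesis
  proof (cases "y = 0")
    case True
    \<comment> \<open>Witnesses are listed as \<open>u1\<close>, \<open>v1\<close>,
      \<open>v2\<close>, \<open>u2\<close>; \<open>(v1, v2)\<close> is the first row, or the second
      if the first is zero.\<close>
    then show ?thesis using \<open>x = 0\<close> by (intro that[of 0 z w 1]) auto
  next
    case False
    then show ?thesis using \<open>x = 0\<close> assms by (intro that[of 1 0 y "w / y"]) auto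
  qed
next
  case False
  then show ?thesis using assms by (intro that[of 1 x y "z / x"]) (auto simp: field_simps)
qed

text \<open>The trace \<open>t\<close> is normalised. Outside characteristic two, subtracting
  \<open>t / 2\<close> times the identity completes the square; in characteristic two a nonzero
  trace is scaled to 1.\<close>

lemma companion_pencil_canon:
  fixes v t :: "'a::field"
  shows "\<exists>f\<in>canon_forms. transforms_to (pencil 1 0 0 1 0 v 1 t) (canon_smat f)"
proof (cases "CHAR('a) = 2")
  case False
  define h where "h = t / 2"
  have h: "t = h + h" using False by (simp add: h_def flip: mult_2 two_eq_0_iff_CHAR)
  have "transforms_to (pencil 1 0 0 1 0 v 1 t) (pencil 1 0 0 1 (- h) v 1 h)"
    using pencil_slices[where a = 1 and b = "- h" and c = 0 and d = 1, of 1 0 0 1 0 v 1 t]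
    by (simp add: h)
  also have "transforms_to \<dots> (pencil 1 h 0 1 0 (v + h * h) 1 h)"
    using pencil_rows[where a = 1 and b = 0 and c = h and d = 1, of 1 0 0 1 "- h" v 1 h] by simp
  also have "transforms_to \<dots> (pencil 1 0 0 1 0 (v + h * h) 1 0)"
    using pencil_columns[where a = 1 and b = "- h" and c = 0 and d = 1, of 1 h 0 1 0 "v + h * h" 1 h]
    by simp
  also note pencil_transforms_to_canon(1)
  finally show ?thesis by (rule bexI) (simp add: canon_forms_def)
next
  case True
  show ?thesis
  proof (cases "t = 0")
    case True
    then show ?thesis using pencil_transforms_to_canon(1)[of v]
      by (intro bexI[of _ "CA v"]) (simp_all add: canon_forms_def)
  next
    case t: False
    have "transforms_to (pencil 1 0 0 1 0 v 1 t) (pencil 1 0 0 1 0 (v / t) (1 / t) 1)"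
      using pencil_slices[where a = 1 and b = 0 and c = 0 and d = "1 / t", of 1 0 0 1 0 v 1 t] t
      by simp
    also have "transforms_to \<dots> (pencil 1 0 0 t 0 (v / t) 1 t)"
      using pencil_rows[where a = 1 and b = 0 and c = 0 and d = t, of 1 0 0 1 0 "v / t" "1 / t" 1] t
      by simp
    also have "transforms_to \<dots> (pencil 1 0 0 1 0 (v / t / t) 1 1)"
      using pencil_columns[where a = 1 and b = 0 and c = 0 and d = "1 / t", of 1 0 0 t 0 "v / t" 1 t] t
      by simp
    also note pencil_transforms_to_canon(2)
    finally show ?thesis by (rule bexI) (simp add: canon_forms_def True)
  qed
qed

text \<open>For \<open>r \<noteq> 0\<close> the first unit vector is cyclic for the second slice. It
  and its image \<open>(p, r)\<close> form a basis in which that slice is a companion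
  matrix.\<close>

lemma cyclic_pencil_canon:
  fixes p q r s :: "'a::field"
  assumes r: "r \<noteq> 0"
  shows "\<exists>f\<in>canon_forms. transforms_to (pencil 1 0 0 1 p q r s) (canon_smat f)"
proof -
  have "transforms_to (pencil 1 0 0 1 p q r s)
      (pencil 1 p 0 r p (p * p + r * q) r (p * r + r * s))"
    using pencil_columns[where a = 1 and b = p and c = 0 and d = r, of 1 0 0 1 p q r s] by simp
  also have "transforms_to \<dots> (pencil 1 0 0 1 0 (r * q - p * s) 1 (p + s))"
  proof -
    have e: "p * p + r * q - p * (p * r + r * s) / r = r * q - p * s" "(p * r + r * s) / r = p + s"
      using r by (simp_all add: field_simps)
    show ?thesis
      using pencil_rows[where a = 1 and b = 0 and c = "- p / r" and d = "1 / r",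
        of 1 p 0 r p "p * p + r * q" r "p * r + r * s"] r e by simp
  qed
  finally show ?thesis
    by (rule canon_if_transforms[OF _ companion_pencil_canon])
qed

text \<open>A nonscalar matrix has a cyclic vector: the first unit vector, the second one if
  \<open>r = 0\<close> and \<open>q \<noteq> 0\<close>, or their sum if the matrix is diagonal with
  distinct entries.\<close>

lemma nonscalar_pencil_canon:
  fixes p q r s :: "'a::field"
  assumes "\<not> (q = 0 \<and> r = 0 \<and> p = s)"
  shows "\<exists>f\<in>canon_forms. transforms_to (pencil 1 0 0 1 p q r s) (canon_smat f)"
proof (cases "r = 0")
  case False
  then show ?thesis by (rule cyclic_pencil_canon)
next
  case r: True
  show ?thesis
  proof (cases "q = 0")
    case False
    have "transforms_to (pencil 1 0 0 1 p q r s) (pencil 0 1 1 0 r s p q)"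
      using pencil_rows[where a = 0 and b = 1 and c = 1 and d = 0, of 1 0 0 1 p q r s] by simp
    also have "transforms_to \<dots> (pencil 1 0 0 1 s r q p)"
      using pencil_columns[where a = 0 and b = 1 and c = 1 and d = 0, of 0 1 1 0 r s p q] by simp
    finally show ?thesis
      by (rule canon_if_transforms[OF _ cyclic_pencil_canon[OF False]])
  next
    case q: True
    then have "s - p \<noteq> 0" using assms r by auto
    have "transforms_to (pencil 1 0 0 1 p q r s) (pencil 1 0 1 1 p 0 s s)"
      using pencil_columns[where a = 1 and b = 0 and c = 1 and d = 1, of 1 0 0 1 p q r s] q r by simp
    also have "transforms_to \<dots> (pencil 1 0 0 1 p 0 (s - p) s)"
      using pencil_rows[where a = 1 and b = "- 1" and c = 0 and d = 1, of 1 0 1 1 p 0 s s] by simp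
    finally show ?thesis
      by (rule canon_if_transforms[OF _ cyclic_pencil_canon[OF \<open>s - p \<noteq> 0\<close>]])
  qed
qed

text \<open>Multiplying both slices by the inverse of the first gives the identity and a matrix with
  entries \<open>p\<close>, \<open>q\<close>, \<open>r\<close>, \<open>s\<close>. It is not scalar
  because the second slice is no multiple of the first.\<close>

lemma nonsingular_pencil_canon:
  fixes x y z w x' y' z' w' :: "'a::field"
  assumes D: "x * w - y * z \<noteq> 0"
    and indep: "\<And>c. \<not> (x' = c * x \<and> y' = c * y \<and> z' = c * z \<and> w' = c * w)"
  shows "\<exists>f\<in>canon_forms. transforms_to (pencil x y z w x' y' z' w') (canon_smat f)"
proof -
  define D where "D = x * w - y * z"
  define p q r s where "p = w / D * x' + - y / D * z'" and "q = w / D * y' + - y / D * w'"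
    and "r = - z / D * x' + x / D * z'" and "s = - z / D * y' + x / D * w'"
  have D0: "D \<noteq> 0" using D by (simp add: D_def)
  have e: "w / D * x + - y / D * z = 1" "w / D * y + - y / D * w = 0"
    "- z / D * x + x / D * z = 0" "- z / D * y + x / D * w = 1"
    using D0 by (simp_all add: D_def mult.commute flip: diff_divide_distrib)
  have "transforms_to (pencil x y z w x' y' z' w') (pencil 1 0 0 1 p q r s)"
    using pencil_rows[where a = "w / D" and b = "- z / D" and c = "- y / D" and d = "x / D",
        of x y z w x' y' z' w'] unfolding e p_def q_def r_def s_def .
  moreover have "\<not> (q = 0 \<and> r = 0 \<and> p = s)"
  proof
    assume *: "q = 0 \<and> r = 0 \<and> p = s"
    have "x * (D * p) + y * (D * r) = D * x'" "x * (D * q) + y * (D * s) = D * y'"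
      "z * (D * p) + w * (D * r) = D * z'" "z * (D * q) + w * (D * s) = D * w'"
    proof -
      have D': "D * p = w * x' - y * z'" "D * q = w * y' - y * w'"
        "D * r = x * z' - z * x'" "D * s = x * w' - z * y'"
        using D0 by (simp_all add: p_def q_def r_def s_def field_simps)
      show "x * (D * p) + y * (D * r) = D * x'" "x * (D * q) + y * (D * s) = D * y'"
        "z * (D * p) + w * (D * r) = D * z'" "z * (D * q) + w * (D * s) = D * w'"
        unfolding D' by (simp_all add: D_def algebra_simps)
    qed
    then have "D * (s * x) = D * x'" "D * (s * y) = D * y'" "D * (s * z) = D * z'" "D * (s * w) = D * w'"
      using * by (simp_all add: mult_ac)
    then show False using indep[of s] D0 by simp
  qed
  ultimately show ?thesis by (intro canon_if_transforms[OF _ nonscalar_pencil_canon])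
qed

text \<open>One of the first slice, the second slice and their sum is nonsingular, even over the
  field with two elements. Otherwise both slices have rank at most one and the rows or the columns
  are dependent.\<close>

lemma regular_222_canon:
  fixes a :: "nat \<Rightarrow> nat \<Rightarrow> nat \<Rightarrow> 'a::field"
  assumes reg: "regular_smat (2, 2, 2, a)"
  shows "\<exists>f\<in>canon_forms. transforms_to (2, 2, 2, a) (canon_smat f)"
proof -
  define x y z w where "x = a 0 0 0" and "y = a 0 1 0" and "z = a 1 0 0" and "w = a 1 1 0"
  define x' y' z' w' where "x' = a 0 0 1" and "y' = a 0 1 1" and "z' = a 1 0 1" and "w' = a 1 1 1"
  note ds = x_def y_def z_def w_def x'_def y'_def z'_def w'_def
  have slices: "c = 0 \<and> d = 0" if hyps: "c * x + d * x' = 0" "c * y + d * y' = 0"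
    "c * z + d * z' = 0" "c * w + d * w' = 0" for c d
  proof -
    have "(if l = 0 then c else d) = 0" if "l < 2" for l :: nat
      by (rule regular_smatD(1)[OF reg _ that, of "\<lambda>l. if l = 0 then c else d"])
        (use hyps in \<open>auto simp: ds numeral_eq_Suc less_Suc_eq\<close>)
    from this[of 0] this[of 1] show ?thesis by simp
  qed
  have columns: "c = 0 \<and> d = 0" if hyps: "c * x + d * y = 0" "c * x' + d * y' = 0"
    "c * z + d * w = 0" "c * z' + d * w' = 0" for c d
  proof -
    have "(if l = 0 then c else d) = 0" if "l < 2" for l :: nat
      by (rule regular_smatD(2)[OF reg _ that, of "\<lambda>l. if l = 0 then c else d"])
        (use hyps in \<open>auto simp: ds numeral_eq_Suc less_Suc_eq\<close>)
    from this[of 0] this[of 1] show ?thesis by simp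
  qed
  have rows: "c = 0 \<and> d = 0" if hyps: "c * x + d * z = 0" "c * x' + d * z' = 0"
    "c * y + d * w = 0" "c * y' + d * w' = 0" for c d
  proof -
    have "(if l = 0 then c else d) = 0" if "l < 2" for l :: nat
      by (rule regular_smatD(3)[OF reg _ that, of "\<lambda>l. if l = 0 then c else d"])
        (use hyps in \<open>auto simp: ds numeral_eq_Suc less_Suc_eq\<close>)
    from this[of 0] this[of 1] show ?thesis by simp
  qed
  have "\<exists>f\<in>canon_forms. transforms_to (pencil x y z w x' y' z' w') (canon_smat f)"
  proof -
    consider "x * w - y * z \<noteq> 0" | "x' * w' - y' * z' \<noteq> 0"
      | "(x + x') * (w + w') - (y + y') * (z + z') \<noteq> 0"
      | "x * w - y * z = 0" "x' * w' - y' * z' = 0" "(x + x') * (w + w') - (y + y') * (z + z') = 0"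
      by blast
    then show ?thesis
    proof cases
      case 1
      then show ?thesis
      proof (rule nonsingular_pencil_canon, safe)
        fix c assume "x' = c * x" "y' = c * y" "z' = c * z" "w' = c * w"
        then show False using slices[of c "- 1"] by simp
      qed
    next
      case 2
      then have "\<exists>f\<in>canon_forms. transforms_to (pencil x' y' z' w' x y z w) (canon_smat f)"
      proof (rule nonsingular_pencil_canon, safe)
        fix c assume "x = c * x'" "y = c * y'" "z = c * z'" "w = c * w'"
        then show False using slices[of "- 1" c] by simp
      qed
      moreover have "transforms_to (pencil x y z w x' y' z' w') (pencil x' y' z' w' x y z w)"
        using pencil_slices[where a = 0 and b = 1 and c = 1 and d = 0, of x y z w x' y' z' w'] by simp
      ultimately show ?thesis by (rule canon_if_transforms[rotated])
    next
      case 3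
      then have "\<exists>f\<in>canon_forms.
          transforms_to (pencil (x + x') (y + y') (z + z') (w + w') x y z w) (canon_smat f)"
      proof (rule nonsingular_pencil_canon, safe)
        fix c
        assume "x = c * (x + x')" "y = c * (y + y')" "z = c * (z + z')" "w = c * (w + w')"
        then have "(c - 1) * x + c * x' = 0" "(c - 1) * y + c * y' = 0"
          "(c - 1) * z + c * z' = 0" "(c - 1) * w + c * w' = 0"
          by (simp_all add: algebra_simps)
        then have "c - 1 = 0 \<and> c = 0" by (rule slices)
        then show False by auto
      qed
      moreover have "transforms_to (pencil x y z w x' y' z' w')
          (pencil (x + x') (y + y') (z + z') (w + w') x y z w)"
        using pencil_slices[where a = 1 and b = 1 and c = 1 and d = 0, of x y z w x' y' z' w'] by simp
      ultimately show ?thesis by (rule canon_if_transforms[rotated])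
    next
      case 4
      have "x * w = y * z" "x' * w' = y' * z'" using 4 by simp_all
      obtain u1 u2 v1 v2 where u: "x = u1 * v1" "y = u1 * v2" "z = u2 * v1" "w = u2 * v2"
        using rank_one_factor[OF \<open>x * w = y * z\<close>] .
      obtain p1 p2 q1 q2 where p: "x' = p1 * q1" "y' = p1 * q2" "z' = p2 * q1" "w' = p2 * q2"
        using rank_one_factor[OF \<open>x' * w' = y' * z'\<close>] .
      \<comment> \<open>The determinant of \<open>u v^T + p q^T\<close> is the product of the
        determinants of \<open>(u, p)\<close> and \<open>(v, q)\<close>.\<close>
      have "(u1 * p2 - u2 * p1) * (v1 * q2 - v2 * q1) =
          (x + x') * (w + w') - (y + y') * (z + z')"
        unfolding u p by (simp add: algebra_simps)
      then consider "u1 * p2 = u2 * p1" | "v1 * q2 = v2 * q1" using 4(3) by auto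
      then have False
      proof cases
        case 1
        then obtain c d where cd: "c \<noteq> 0 \<or> d \<noteq> 0" "c * u1 + d * u2 = 0" "c * p1 + d * p2 = 0"
          by (rule common_orthogonal)
        have "c = 0 \<and> d = 0"
          unfolding u p
          by (rule rows[unfolded u p])
            (simp_all add: cd flip: mult.assoc distrib_right)
        then show False using cd by simp
      next
        case 2
        then obtain c d where cd: "c \<noteq> 0 \<or> d \<noteq> 0" "c * v1 + d * v2 = 0" "c * q1 + d * q2 = 0"
          by (rule common_orthogonal)
        have "c * (l * v1) + d * (l * v2) = 0" "c * (l * q1) + d * (l * q2) = 0" for l
          using arg_cong[OF cd(2), of "\<lambda>t. l * t"] arg_cong[OF cd(3), of "\<lambda>t. l * t"]
          by (simp_all add: algebra_simps)
        then have "c = 0 \<and> d = 0" by (intro columns) (simp_all only: u p)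
        then show False using cd by simp
      qed
      then show ?thesis ..
    qed
  qed
  then show ?thesis unfolding ds by (rule canon_if_transforms[OF transforms_to_pencil])
qed

section \<open>The formats 1 x 2 x 2 and 3 x 2 x 2\<close>

lemma regular_122_canon:
  fixes a :: "nat \<Rightarrow> nat \<Rightarrow> nat \<Rightarrow> 'a::field"
  assumes reg: "regular_smat (1, 2, 2, a)"
  shows "transforms_to (1, 2, 2, a) (canon_smat C4)"
proof -
  \<comment> \<open>The determinant of the matrix indexed by \<open>j\<close> and \<open>k\<close>;
    the inverse of that matrix is the slice change \<open>t\<close> below.\<close>
  define D where "D = a 0 0 0 * a 0 1 1 - a 0 0 1 * a 0 1 0"
  have D: "D \<noteq> 0"
  proof
    assume "D = 0"
    then have "a 0 0 0 * a 0 1 1 = a 0 0 1 * a 0 1 0" by (simp add: D_def)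
    then obtain c d where cd: "c \<noteq> 0 \<or> d \<noteq> 0" "c * a 0 0 0 + d * a 0 0 1 = 0"
      "c * a 0 1 0 + d * a 0 1 1 = 0"
      by (rule common_orthogonal)
    have "(if l = 0 then c else d) = 0" if "l < 2" for l :: nat
      by (rule regular_smatD(1)[OF reg _ that, of "\<lambda>l. if l = 0 then c else d"])
        (use cd in \<open>auto simp: numeral_eq_Suc less_Suc_eq\<close>)
    from this[of 0] this[of 1] show False using cd(1) by simp
  qed
  have e: "a 0 0 0 * (a 0 1 1 / D) + a 0 0 1 * (- a 0 1 0 / D) = 1"
    "a 0 1 0 * (- a 0 0 1 / D) + a 0 1 1 * (a 0 0 0 / D) = 1"
    using D by (simp_all add: D_def mult.commute flip: diff_divide_distrib)
  have "transforms_to (1, 2, 2, a) (1, 2, 2, \<lambda>i j k. [[[1, 0]], [[0, 1]]] ! k ! i ! j)"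
    by (rule transforms_toI[where r = "\<lambda>_ _. 1" and s = "mat2 1 0 0 1"
          and t = "mat2 (a 0 1 1 / D) (- a 0 0 1 / D) (- a 0 1 0 / D) (a 0 0 0 / D)"])
      (use e in \<open>simp add: act_def numeral_eq_Suc All_less_Suc mult.commute\<close>)
  then show ?thesis by (simp add: of_slices_def numeral_eq_Suc)
qed

lemma complete_to_det_one:
  fixes u1 u2 :: "'a::field"
  assumes "u1 \<noteq> 0 \<or> u2 \<noteq> 0"
  obtains v1 v2 where "u1 * v2 - u2 * v1 = 1"
proof (cases "u1 = 0")
  case True
  then show ?thesis using assms by (intro that[of 0 "- 1 / u2"]) auto
next
  case False
  then show ?thesis by (intro that[of "1 / u1" 0]) auto
qed

text \<open>The row space of a regular \<open>3 \<times> 2 \<times> 2\<close> spatial matrix is the orthogonal complement of a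
  single nonzero \<open>2 \<times> 2\<close> matrix \<open>N\<close>, whose rank decides between the forms (5) and (6).\<close>

lemma regular_322_canon:
  fixes a :: "nat \<Rightarrow> nat \<Rightarrow> nat \<Rightarrow> 'a::field"
  assumes reg: "regular_smat (3, 2, 2, a)"
  shows "\<exists>f\<in>{C5, C6}. transforms_to (3, 2, 2, a) (canon_smat f)"
proof -
  let ?J = "{..<2::nat} \<times> {..<2::nat}"
  have sumJ: "(\<Sum>p\<in>?J. f p) = f (0, 0) + f (0, 1) + f (1, 0) + f (1, 1)" for f :: "nat \<times> nat \<Rightarrow> 'a"
  proof -
    have "(\<Sum>p\<in>?J. f p) = (\<Sum>j<2. \<Sum>k<2. f (j, k))" by (simp add: sum.cartesian_product)
    then show ?thesis by (simp add: numeral_eq_Suc add.assoc)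
  qed
  \<comment> \<open>Three linear equations in the four unknowns \<open>N p\<close>, one for each row
    of \<open>a\<close>.\<close>
  have "\<exists>N. (\<exists>p\<in>?J. N p \<noteq> 0) \<and>
      (\<forall>i\<in>{..<3::nat}. (\<Sum>p\<in>?J. N p * (case p of (j, k) \<Rightarrow> a i j k)) = 0)"
    by (rule nontrivial_relation) auto
  then obtain N where N: "\<exists>p\<in>?J. N p \<noteq> 0"
    and orth: "\<And>i. i < 3 \<Longrightarrow> (\<Sum>p\<in>?J. (case p of (j, k) \<Rightarrow> a i j k) * N p) = 0"
    by (auto simp: mult.commute)
  define x y z w where "x = N (0, 0)" and "y = N (0, 1)" and "z = N (1, 0)" and "w = N (1, 1)"
  have tr: "transforms_to (3, 2, 2, a) (3, 2, 2, b)"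
    if "\<And>i. i < 3 \<Longrightarrow> b i 0 0 * x + b i 0 1 * y + b i 1 0 * z + b i 1 1 * w = 0" for b
  proof (rule transforms_to_if_hyperplane[OF reg _ N orth])
    fix i :: nat assume "i < 3"
    then show "(\<Sum>p\<in>?J. (case p of (j, k) \<Rightarrow> b i j k) * N p) = 0"
      using that[of i] unfolding sumJ by (simp add: x_def y_def z_def w_def)
  qed auto
  show ?thesis
  proof (cases "x * w = y * z")
    case False
    define D where "D = x * w - y * z"
    have D: "D \<noteq> 0" using False by (simp add: D_def)
    \<comment> \<open>Row \<open>i\<close> of \<open>b\<close> is row \<open>i\<close> of form (6),
      as a matrix in \<open>j\<close> and \<open>k\<close>, times the inverse of the slice change
      \<open>mat2 (- z) x (- w) y\<close>. That matrix has determinant \<open>D\<close> and is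
      chosen to make these rows orthogonal to \<open>N\<close>.\<close>
    define b where "b i j k = (if i = 0 then mat2 (y / D) (- x / D) 0 0 j k
      else if i = 1 then mat2 (w / D) (- z / D) (y / D) (- x / D) j k
      else mat2 0 0 (w / D) (- z / D) j k)" for i j k :: nat
    have "transforms_to (3, 2, 2, a) (3, 2, 2, b)"
      by (rule tr) (auto simp: b_def algebra_simps)
    also have "transforms_to (3, 2, 2, b) (canon_smat C6)"
    proof -
      have e: "x * w / D - y * z / D = 1" using D by (simp add: D_def flip: diff_divide_distrib)
      have "transforms_to (3, 2, 2, b)
          (3, 2, 2, \<lambda>i j k. [[[1, 0], [0, 1], [0, 0]], [[0, 0], [1, 0], [0, 1]]] ! k ! i ! j)"
        by (rule transforms_toI[where r = "\<lambda>i j. if i = j then 1 else 0" and s = "mat2 1 0 0 1"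
              and t = "mat2 (- z) x (- w) y"])
          (use e in \<open>simp add: act_def numeral_eq_Suc All_less_Suc b_def algebra_simps\<close>)
      then show ?thesis by (simp add: of_slices_def numeral_eq_Suc)
    qed
    finally show ?thesis by blast
  next
    case True
    then obtain u1 u2 v1 v2 where uv: "x = u1 * v1" "y = u1 * v2" "z = u2 * v1" "w = u2 * v2"
      by (rule rank_one_factor)
    have nz: "x \<noteq> 0 \<or> y \<noteq> 0 \<or> z \<noteq> 0 \<or> w \<noteq> 0"
      using N by (auto simp: x_def y_def z_def w_def numeral_eq_Suc less_Suc_eq)
    have "u1 \<noteq> 0 \<or> u2 \<noteq> 0" "v1 \<noteq> 0 \<or> v2 \<noteq> 0" using nz by (auto simp: uv)
    obtain p1 p2 where p: "u1 * p2 - u2 * p1 = 1"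
      using complete_to_det_one[OF \<open>u1 \<noteq> 0 \<or> u2 \<noteq> 0\<close>] .
    obtain q1 q2 where q: "v1 * q2 - v2 * q1 = 1"
      using complete_to_det_one[OF \<open>v1 \<noteq> 0 \<or> v2 \<noteq> 0\<close>] .
    \<comment> \<open>Now \<open>N = u v^T\<close>. The vectors \<open>\<sigma>\<close> form the
      dual basis of \<open>u, p\<close>, and the vectors \<open>\<tau>\<close> that of
      \<open>- q, v\<close>. Row \<open>i\<close> of \<open>b\<close> is a tensor of dual vectors;
      the omitted fourth tensor is the one pairing nontrivially with \<open>N\<close>.\<close>
    define \<sigma> where "\<sigma> i = (if i = 0 then (p2, - p1) else (- u2, u1))" for i :: nat
    define \<tau> where "\<tau> i = (if i = 2 then (q2, - q1) else (v2, - v1))" for i :: nat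
    define b where "b i j k = (if j = 0 then fst (\<sigma> i) else snd (\<sigma> i)) *
      (if k = 0 then fst (\<tau> i) else snd (\<tau> i))" for i j k :: nat
    have "transforms_to (3, 2, 2, a) (3, 2, 2, b)"
      by (rule tr) (auto simp: b_def \<sigma>_def \<tau>_def uv algebra_simps)
    also have "transforms_to (3, 2, 2, b) (canon_smat C5)"
    proof -
      let ?\<sigma> = "\<lambda>i j. fst (\<sigma> i) * mat2 u1 p1 u2 p2 0 j + snd (\<sigma> i) * mat2 u1 p1 u2 p2 1 j"
      let ?\<tau> = "\<lambda>i k. fst (\<tau> i) * mat2 (- q1) v1 (- q2) v2 0 k + snd (\<tau> i) * mat2 (- q1) v1 (- q2) v2 1 k"
      \<comment> \<open>Rows of \<open>b\<close> are pure tensors, so the column and slice changes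
        act on the two factors separately.\<close>
      have act: "act 3 2 2 (\<lambda>i j. if i = j then 1 else 0) (mat2 u1 p1 u2 p2) (mat2 (- q1) v1 (- q2) v2) b i j k =
          ?\<sigma> i j * ?\<tau> i k" if "i < 3" for i j k
      proof -
        have "act 3 2 2 (\<lambda>i j. if i = j then 1 else 0) (mat2 u1 p1 u2 p2) (mat2 (- q1) v1 (- q2) v2) b i j k =
          (\<Sum>l<3. if l = i then ?\<sigma> l j * ?\<tau> l k else 0)"
          unfolding act_def
          by (rule sum.cong) (auto simp: b_def numeral_eq_Suc algebra_simps)
        then show ?thesis using that by simp
      qed
      have "p2 * u1 - p1 * u2 = 1" "u1 * p2 - u2 * p1 = 1" "v1 * q2 - v2 * q1 = 1" "q2 * v1 - q1 * v2 = 1"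
        using p q by (simp_all add: mult.commute)
      then have "\<forall>i<3. \<forall>j<2. \<forall>k<2. [[[1, 0], [0, 1], [0, 0]], [[0, 0], [0, 0], [0, 1]]] ! k ! i ! j =
          ?\<sigma> i j * ?\<tau> i k"
        by (simp add: numeral_3_eq_3 numeral_2_eq_2 All_less_Suc \<sigma>_def \<tau>_def mult.commute)
      then have "transforms_to (3, 2, 2, b)
          (3, 2, 2, \<lambda>i j k. [[[1, 0], [0, 1], [0, 0]], [[0, 0], [0, 0], [0, 1]]] ! k ! i ! j)"
        by (intro transforms_toI[where r = "\<lambda>i j. if i = j then 1 else 0" and s = "mat2 u1 p1 u2 p2"
              and t = "mat2 (- q1) v1 (- q2) v2"]) (simp add: act)
      then show ?thesis by (simp add: of_slices_def numeral_eq_Suc)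
    qed
    finally show ?thesis by blast
  qed
qed

section \<open>Assembling the classification\<close>

lemma canon_smat_dims:
  "\<exists>b. canon_smat C1 = (1, 1, 1, b)" "\<exists>b. canon_smat C2 = (2, 2, 1, b)"
  "\<exists>b. canon_smat C3 = (2, 1, 2, b)" "\<exists>b. canon_smat C7 = (4, 2, 2, b)"
  by (simp_all add: of_slices_def numeral_eq_Suc)

lemma regular_smat_canon:
  fixes a :: "nat \<Rightarrow> nat \<Rightarrow> nat \<Rightarrow> 'a::field"
  assumes "1 \<le> m" "1 \<le> n" "1 \<le> q" "n \<le> 2" "q \<le> 2" and reg: "regular_smat (m, n, q, a)"
  shows "\<exists>f\<in>canon_forms. equiv_smat (m, n, q, a) (canon_smat f)"
proof -
  have full: "transforms_to (m, n, q, a) (canon_smat f)"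
    if "m = n * q" "\<exists>b. canon_smat f = (m, n, q, b)" for f
    using transforms_to_if_full[OF reg that(1)] that(2) by auto
  have "n = 1 \<or> n = 2" "q = 1 \<or> q = 2" using assms by auto
  moreover have "m \<le> 2 * 2"
    using regular_smat_dims(1)[OF reg] mult_le_mono[OF assms(4,5)] by linarith
  then have "m = 1 \<or> m = 2 \<or> m = 3 \<or> m = 4" using assms(1) by linarith
  \<comment> \<open>The dimension bounds leave seven formats; the four with \<open>m = n * q\<close>
    have a single class each.\<close>
  ultimately consider "n = 1" "q = 1" "m = 1" | "n = 2" "q = 1" "m = 2" | "n = 1" "q = 2" "m = 2"
    | "n = 2" "q = 2" "m = 1" | "n = 2" "q = 2" "m = 2" | "n = 2" "q = 2" "m = 3"
    | "n = 2" "q = 2" "m = 4"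
    using regular_smat_dims[OF reg] by (elim disjE) simp_all
  then have "\<exists>f\<in>canon_forms. transforms_to (m, n, q, a) (canon_smat f)"
  proof cases
    case 1
    then show ?thesis using full[of C1] canon_smat_dims
      by (intro bexI[of _ C1]) (simp_all add: canon_forms_def)
  next
    case 2
    then show ?thesis using full[of C2] canon_smat_dims
      by (intro bexI[of _ C2]) (simp_all add: canon_forms_def)
  next
    case 3
    then show ?thesis using full[of C3] canon_smat_dims
      by (intro bexI[of _ C3]) (simp_all add: canon_forms_def)
  next
    case 4
    then show ?thesis using regular_122_canon[of a] reg
      by (intro bexI[of _ C4]) (simp_all add: canon_forms_def)
  next
    case 5
    then show ?thesis using regular_222_canon[of a] reg by simp
  next
    case 6
    then show ?thesis using regular_322_canon[of a] reg by (auto simp: canon_forms_def)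
  next
    case 7
    then show ?thesis using full[of C7] canon_smat_dims
      by (intro bexI[of _ C7]) (simp_all add: canon_forms_def)
  qed
  then show ?thesis using equiv_smatI regular_canon_smat by blast
qed

lemma equiv_canon_same_dims:
  assumes "equiv_smat (canon_smat f) (canon_smat g)"
  shows "f = g \<or> f \<in> {C5, C6} \<and> g \<in> {C5, C6} \<or>
    f \<in> range CA \<union> range CB \<union> {CD} \<and> g \<in> range CA \<union> range CB \<union> {CD}"
proof -
  have "fst (canon_smat f) = fst (canon_smat g)"
    "fst (snd (canon_smat f)) = fst (snd (canon_smat g))"
    "fst (snd (snd (canon_smat f))) = fst (snd (snd (canon_smat g)))"
    using assms by (auto simp: equiv_smat_def)
  then show ?thesis by (cases f; cases g; simp add: of_slices_def)
qed

lemma not_equiv_C5_C6: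
  "\<not> equiv_smat (canon_smat C5) (canon_smat C6)" "\<not> equiv_smat (canon_smat C6) (canon_smat C5)"
  using degenerate_if_equiv degenerate_C5 not_degenerate_C6 equiv_smat_sym by blast+

lemma equiv_canon_imp_rel:
  fixes f g :: "'a::field canon"
  assumes "f \<in> canon_forms" "g \<in> canon_forms" and e: "equiv_smat (canon_smat f) (canon_smat g)"
  shows "f = g \<or> canon_rel f g"
proof -
  consider "f = g" | "f \<in> {C5, C6}" "g \<in> {C5, C6}"
    | v v' where "f = CA v" "g = CA v'"
    | v v' where "f = CA v" "g = CB v'" "CHAR('a) = 2"
    | v v' where "f = CB v" "g = CA v'" "CHAR('a) = 2"
    | v v' where "f = CB v" "g = CB v'" "CHAR('a) = 2"
    using equiv_canon_same_dims[OF e] assms(1,2)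
    by (auto simp: canon_forms_def split: if_splits)
  then show ?thesis
  proof cases
    case 2
    then show ?thesis using e not_equiv_C5_C6 by auto
  next
    case 3
    then show ?thesis using e equiv_CA_CA by blast
  next
    case 4
    then show ?thesis using e not_equiv_CA_CB by blast
  next
    case 5
    then show ?thesis using e not_equiv_CA_CB equiv_smat_sym by blast
  next
    case 6
    then show ?thesis using e equiv_CB_CB by blast
  qed simp
qed

lemma transforms_to_refl: "transforms_to A A"
  by (cases A) (auto intro: transforms_to_pointwise)

lemma rel_imp_equiv_canon:
  fixes f g :: "'a::field canon"
  assumes "canon_rel f g"
  shows "equiv_smat (canon_smat f) (canon_smat g)"
proof (rule equiv_smatI[OF _ regular_canon_smat])
  show "transforms_to (canon_smat f) (canon_smat g)"
  proof (cases "CHAR('a) = 2")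
    case False
    then obtain v z where z: "f = CA v" "g = CA (v * z)" "z \<noteq> 0" "is_square z"
      using assms by (auto simp: canon_rel_def)
    then obtain c where "z = c\<^sup>2" by (auto simp: is_square_def)
    then show ?thesis using CA_transforms_scale[of c v] z by (simp del: canon_smat.simps)
  next
    case True
    then have two: "(2 :: 'a) = 0" by (simp add: two_eq_0_iff_CHAR)
    \<comment> \<open>The names match \<open>CA_transforms_moebius\<close>:
      \<open>\<alpha> = d^2\<close>, \<open>\<beta> = b^2\<close>, \<open>\<gamma> = c^2\<close>,
      \<open>\<delta> = a^2\<close>.\<close>
    consider v a b c d where "f = CA v" "g = CA ((d\<^sup>2 * v + b\<^sup>2) / (c\<^sup>2 * v + a\<^sup>2))"
        "d\<^sup>2 * a\<^sup>2 + b\<^sup>2 * c\<^sup>2 \<noteq> 0" "c\<^sup>2 * v + a\<^sup>2 \<noteq> 0"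
      | v b where "f = CB v" "g = CB (v + b + b\<^sup>2)"
      using assms True unfolding canon_rel_def is_square_def by (simp, blast)
    then show ?thesis
    proof cases
      case 1
      have "(a * d + b * c)\<^sup>2 = d\<^sup>2 * a\<^sup>2 + b\<^sup>2 * c\<^sup>2"
        using two by (simp add: power2_sum power_mult_distrib mult.commute)
      then have "a * d + b * c \<noteq> 0" using 1 by auto
      then show ?thesis
        using CA_transforms_moebius[OF two, of a d b c v] 1 by (simp add: add.commute mult.commute)
    next
      case 2
      then show ?thesis using CB_transforms_shift[OF two] by blast
    qed
  qed
qed

section \<open>Algebraically closed fields\<close>

lemma alg_closed_canon:
  fixes f :: "'a::field canon"
  assumes closed: "\<forall>p :: 'a poly. degree p > 0 \<longrightarrow> (\<exists>x. poly p x = 0)"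
    and "f \<in> canon_forms"
  shows "\<exists>g\<in>alg_closed_forms. transforms_to (canon_smat f) (canon_smat g)"
proof -
  have root: "\<exists>x. x\<^sup>2 + b * x + c = 0" for b c :: 'a
    using closed[rule_format, of "[:c, b, 1:]"] by (auto simp: power2_eq_square algebra_simps)
  consider "f \<in> alg_closed_forms" | v where "f = CA v" | v where "f = CB v" "CHAR('a) = 2"
    using assms(2) by (auto simp: canon_forms_def alg_closed_forms_def split: if_splits)
  then show ?thesis
  proof cases
    case 1
    then show ?thesis using transforms_to_refl by blast
  next
    case (2 v)
    obtain w where "w\<^sup>2 - v = 0" using root[of 0 "- v"] by auto
    then have w: "v = w\<^sup>2" by simp
    show ?thesis
    proof (cases "(2 :: 'a) = 0")
      case True
      \<comment> \<open>The Moebius map used is the translation of \<open>v\<close> by the square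
        \<open>w^2 = v\<close>.\<close>
      have "(w\<^sup>2 + v) / 1 = 0" using char_2_simps(1)[OF True] w by simp
      then have "transforms_to (canon_smat f) (canon_smat (CA 0))"
        using CA_transforms_moebius[OF True, of 1 1 w 0 v] 2 by simp
      then show ?thesis by (rule bexI) (simp add: alg_closed_forms_def)
    next
      case False
      show ?thesis
      proof (cases "w = 0")
        case True
        then show ?thesis using 2 w transforms_to_refl[of "canon_smat (CA 0)"]
          by (intro bexI[of _ "CA 0"]) (simp_all add: alg_closed_forms_def)
      next
        case w0: False
        have "transforms_to (canon_smat f) (canon_smat CD)"
          using CA_transforms_CD[OF False w0] 2 w by simp
        then show ?thesis by (rule bexI) (simp add: alg_closed_forms_def)
      qed
    qed
  next
    case (3 v)
    then have two: "(2 :: 'a) = 0" by (simp add: two_eq_0_iff_CHAR)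
    \<comment> \<open>The shift \<open>b\<close> is chosen to bring the parameter of
      \<open>CB\<close> to 0.\<close>
    obtain b where "b\<^sup>2 + 1 * b + v = 0" using root by blast
    then have "v + b + b\<^sup>2 = 0" by (simp add: algebra_simps)
    then have "transforms_to (canon_smat f) (canon_smat (CB 0))"
      using CB_transforms_shift[OF two, of v b] 3 by simp
    also note CB_0_transforms_CD
    finally show ?thesis by (rule bexI) (simp add: alg_closed_forms_def)
  qed
qed

text \<open>Separate from \<open>equiv_canon_imp_rel\<close> because \<open>CD\<close> does not
  belong to \<open>canon_forms\<close>.\<close>

lemma equiv_alg_closed_forms_unique:
  fixes f g :: "'a::field canon"
  assumes "f \<in> alg_closed_forms" "g \<in> alg_closed_forms"
    and e: "equiv_smat (canon_smat f) (canon_smat g)"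
  shows "f = g"
proof -
  consider "f = g" | "f \<in> {C5, C6}" "g \<in> {C5, C6}" | "f \<in> {CA 0, CD}" "g \<in> {CA 0, CD}"
    using equiv_canon_same_dims[OF e] assms(1,2) by (auto simp: alg_closed_forms_def)
  then show ?thesis
  proof cases
    case 2
    then show ?thesis using e not_equiv_C5_C6 by auto
  next
    case 3
    then show ?thesis using e not_equiv_CA_0_CD equiv_smat_sym by blast
  qed
qed

theorem theorem2:
  fixes dummy :: "'a::field itself"
  shows "(\<forall>m n q (a :: nat \<Rightarrow> nat \<Rightarrow> nat \<Rightarrow> 'a).
            1 \<le> m \<and> 1 \<le> n \<and> 1 \<le> q \<and> n \<le> 2 \<and> q \<le> 2 \<and> regular_smat (m, n, q, a) \<longrightarrow>
            (\<exists>f \<in> (canon_forms :: 'a canon set). equiv_smat (m, n, q, a) (canon_smat f)))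
       \<and> (\<forall>f \<in> (canon_forms :: 'a canon set). \<forall>g \<in> canon_forms.
            equiv_smat (canon_smat f) (canon_smat g) \<longleftrightarrow> f = g \<or> canon_rel f g)
       \<and> ((\<forall>p :: 'a poly. degree p > 0 \<longrightarrow> (\<exists>x. poly p x = 0)) \<longrightarrow>
            (\<forall>m n q (a :: nat \<Rightarrow> nat \<Rightarrow> nat \<Rightarrow> 'a).
               1 \<le> m \<and> 1 \<le> n \<and> 1 \<le> q \<and> n \<le> 2 \<and> q \<le> 2 \<and> regular_smat (m, n, q, a) \<longrightarrow>
               (\<exists>!f. f \<in> (alg_closed_forms :: 'a canon set) \<and> equiv_smat (m, n, q, a) (canon_smat f))))"
proof (intro conjI allI impI ballI)
  fix m n q and a :: "nat \<Rightarrow> nat \<Rightarrow> nat \<Rightarrow> 'a"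
  assume "1 \<le> m \<and> 1 \<le> n \<and> 1 \<le> q \<and> n \<le> 2 \<and> q \<le> 2 \<and> regular_smat (m, n, q, a)"
  then show "\<exists>f \<in> canon_forms. equiv_smat (m, n, q, a) (canon_smat f)"
    using regular_smat_canon by blast
next
  fix f g :: "'a canon"
  assume "f \<in> canon_forms" "g \<in> canon_forms"
  moreover have "equiv_smat (canon_smat f) (canon_smat f)"
    by (rule equiv_smatI[OF transforms_to_refl regular_canon_smat])
  ultimately show "equiv_smat (canon_smat f) (canon_smat g) \<longleftrightarrow> f = g \<or> canon_rel f g"
    using equiv_canon_imp_rel rel_imp_equiv_canon by blast
next
  fix m n q and a :: "nat \<Rightarrow> nat \<Rightarrow> nat \<Rightarrow> 'a"
  assume closed: "\<forall>p :: 'a poly. degree p > 0 \<longrightarrow> (\<exists>x. poly p x = 0)"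
    and "1 \<le> m \<and> 1 \<le> n \<and> 1 \<le> q \<and> n \<le> 2 \<and> q \<le> 2 \<and> regular_smat (m, n, q, a)"
  then obtain f where f: "f \<in> canon_forms" "equiv_smat (m, n, q, a) (canon_smat f)"
    using regular_smat_canon by blast
  obtain g where g: "g \<in> alg_closed_forms" "transforms_to (canon_smat f) (canon_smat g)"
    using alg_closed_canon[OF closed f(1)] by blast
  have eg: "equiv_smat (m, n, q, a) (canon_smat g)"
    by (rule equiv_smatI[OF transforms_to_trans[OF equiv_imp_transforms[OF f(2)] g(2)] regular_canon_smat])
  show "\<exists>!f. f \<in> alg_closed_forms \<and> equiv_smat (m, n, q, a) (canon_smat f)"
  proof (rule ex1I[of _ g])
    fix h assume h: "h \<in> alg_closed_forms \<and> equiv_smat (m, n, q, a) (canon_smat h)"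
    \<comment> \<open>The chain runs from \<open>h\<close> back to the given spatial matrix and on
      to \<open>g\<close>; regularity of \<open>canon_smat g\<close> then restores
      nonsingularity.\<close>
    have "transforms_to (canon_smat h) (canon_smat g)"
      using h eg equiv_smat_sym equiv_imp_transforms transforms_to_trans by blast
    then have "equiv_smat (canon_smat h) (canon_smat g)"
      by (rule equiv_smatI[OF _ regular_canon_smat])
    then show "h = g" using h g(1) equiv_alg_closed_forms_unique by blast
  qed (use g(1) eg in blast)
qed

end
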